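(* The two-stage robust selection problem \textsc{R2ST} under the continuous budgeted uncertainty set $\mathcal{U}^c$, i.e. the problem $$\min_{\mathbf{x}\in\Phi_1}\Big(\mathbf{C}\mathbf{x}+\max_{\mathbf{c}\in\mathcal{U}^c}\ \min_{\mathbf{y}\in\Phi_{\mathbf{x}}}\mathbf{c}\mathbf{y}\Big),$$ is solvable in polynomial time.
   Context: Let $[n]=\{1,\dots,n\}$ and $p\in[n]$. The input consists of $n$, $p$, a vector $\mathbf{C}=(C_1,\dots,C_n)$ of first-stage item costs, nonnegative item costs $\underline{c}_i\le\overline{c}_i$ with $d_i=\overline{c}_i-\underline{c}_i\ge 0$ for $i\in[n]$, and a budget $\Gamma\ge 0$. Products such as $\mathbf{c}\mathbf{y}$ denote $\sum_{i\in[n]}c_iy_i$. $\Phi_1=\{\mathbf{x}\in\{0,1\}^n:\sum_{i\in[n]}x_i\le p\}$. For $\mathbf{x}\in\Phi_1$, $\Phi_{\mathbf{x}}=\{\mathbf{y}\in\{0,1\}^n:\sum_{i\in[n]}(x_i+y_i)=p,\ x_i+y_i\le 1\ \text{for all } i\in[n]\}$. The continuous budgeted uncertainty set is $\mathcal{U}^c=\{(\underline{c}_i+\delta_i)_{i\in[n]}:\delta_i\in[0,d_i],\ \sum_{i\in[n]}\delta_i\le\Gamma\}$. *)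

theory Defs
  imports
    Complex_Main
    "HOL-Library.FuncSet"
    "HOL-Library.Log_Nat"
    "HOL-Computational_Algebra.Polynomial"
begin

section \<open>Polynomial-time solvability\<close>

text \<open>
  The machine model is the random-access machine under the logarithmic cost criterion, presented
  as a structured while language: a program uses finitely many integer registers and an indirectly
  addressable integer memory, and every arithmetic operation and memory access is charged the
  binary length of all numbers involved, addresses included. Multiplication and division are
  primitive; under logarithmic cost this is polynomially equivalent to Turing machines.
\<close>

record ram_state =
  reg :: "nat \<Rightarrow> int"
  mem :: "int \<Rightarrow> int"

definition int_size :: "int \<Rightarrow> nat" where
  "int_size z = 1 + floorlog 2 (nat \<bar>z\<bar>)"

datatype expr =
    Const int
  | Reg nat
  | Mem expr
  | Plus expr expr
  | Minus expr expr
  | Times expr expr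
  | Div expr expr

primrec eval_expr :: "expr \<Rightarrow> ram_state \<Rightarrow> int" where
  "eval_expr (Const k) s = k"
| "eval_expr (Reg r) s = reg s r"
| "eval_expr (Mem e) s = mem s (eval_expr e s)"
| "eval_expr (Plus a b) s = eval_expr a s + eval_expr b s"
| "eval_expr (Minus a b) s = eval_expr a s - eval_expr b s"
| "eval_expr (Times a b) s = eval_expr a s * eval_expr b s"
| "eval_expr (Div a b) s = eval_expr a s div eval_expr b s"

text \<open>Each node is charged the length of its own value, so an operation pays for its operands
  (through the subexpressions) and for its result.\<close>

primrec expr_cost :: "expr \<Rightarrow> ram_state \<Rightarrow> nat" where
  "expr_cost (Const k) s = int_size k"
| "expr_cost (Reg r) s = int_size (reg s r)"
| "expr_cost (Mem e) s = expr_cost e s + int_size (eval_expr (Mem e) s)"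
| "expr_cost (Plus a b) s = expr_cost a s + expr_cost b s + int_size (eval_expr (Plus a b) s)"
| "expr_cost (Minus a b) s = expr_cost a s + expr_cost b s + int_size (eval_expr (Minus a b) s)"
| "expr_cost (Times a b) s = expr_cost a s + expr_cost b s + int_size (eval_expr (Times a b) s)"
| "expr_cost (Div a b) s = expr_cost a s + expr_cost b s + int_size (eval_expr (Div a b) s)"

datatype program =
    Skip
  | Assign nat expr
  | Store expr expr
  | Seq program program
  | IfPos expr program program
  | WhilePos expr program

text \<open>\<open>run c s t s'\<close>: started in \<open>s\<close>, program \<open>c\<close> halts in \<open>s'\<close> at total cost \<open>t\<close>.
  Conditionals and loops test whether the guard is positive.\<close>

inductive run :: "program \<Rightarrow> ram_state \<Rightarrow> nat \<Rightarrow> ram_state \<Rightarrow> bool" where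
  Skip: "run Skip s 1 s"
| Assign: "run (Assign r e) s (1 + expr_cost e s) (s\<lparr>reg := (reg s)(r := eval_expr e s)\<rparr>)"
| Store: "run (Store a e) s (1 + expr_cost a s + expr_cost e s)
    (s\<lparr>mem := (mem s)(eval_expr a s := eval_expr e s)\<rparr>)"
| Seq: "run c1 s1 t1 s2 \<Longrightarrow> run c2 s2 t2 s3 \<Longrightarrow> run (Seq c1 c2) s1 (t1 + t2) s3"
| IfTrue: "eval_expr b s > 0 \<Longrightarrow> run c1 s t s' \<Longrightarrow>
    run (IfPos b c1 c2) s (1 + expr_cost b s + t) s'"
| IfFalse: "\<not> eval_expr b s > 0 \<Longrightarrow> run c2 s t s' \<Longrightarrow>
    run (IfPos b c1 c2) s (1 + expr_cost b s + t) s'"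
| WhileFalse: "\<not> eval_expr b s > 0 \<Longrightarrow> run (WhilePos b c) s (1 + expr_cost b s) s"
| WhileTrue: "eval_expr b s1 > 0 \<Longrightarrow> run c s1 t1 s2 \<Longrightarrow> run (WhilePos b c) s2 t2 s3 \<Longrightarrow>
    run (WhilePos b c) s1 (1 + expr_cost b s1 + t1 + t2) s3"

lemma run_deterministic: "run c s t s' \<Longrightarrow> run c s u s'' \<Longrightarrow> u = t \<and> s'' = s'"
proof (induction arbitrary: u s'' rule: run.induct)
  case (Skip s)
  then show ?case by cases simp
next
  case (Assign r e s)
  then show ?case by cases simp
next
  case (Store a e s)
  then show ?case by cases simp
next
  case (Seq c1 s1 t1 s2 c2 t2 s3)
  from Seq.prems show ?case
  proof cases
    case parts: (Seq u1 r u2)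
    from Seq.IH(1)[OF parts(2)] have "u1 = t1" "r = s2" by simp_all
    with Seq.IH(2)[of u2 s''] parts show ?thesis by simp
  qed
next
  case (IfTrue b s c1 t s' c2)
  from IfTrue.prems show ?case
  proof cases
    case branch: (IfTrue v)
    with IfTrue.IH[of v s''] show ?thesis by simp
  next
    case IfFalse
    with IfTrue.hyps show ?thesis by simp
  qed
next
  case (IfFalse b s c2 t s' c1)
  from IfFalse.prems show ?case
  proof cases
    case branch: (IfFalse v)
    with IfFalse.IH[of v s''] show ?thesis by simp
  next
    case IfTrue
    with IfFalse.hyps show ?thesis by simp
  qed
next
  case (WhileFalse b s c)
  from WhileFalse.prems show ?case
    by cases (use WhileFalse.hyps in auto)
next
  case (WhileTrue b s1 c t1 s2 t2 s3)
  from WhileTrue.prems show ?case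
  proof cases
    case WhileFalse
    with WhileTrue.hyps show ?thesis by simp
  next
    case loop: (WhileTrue u1 r u2)
    from WhileTrue.IH(1)[OF loop(3)] have "u1 = t1" "r = s2" by simp_all
    with WhileTrue.IH(2)[of u2 s''] loop show ?thesis by simp
  qed
qed

text \<open>A word of integers is passed in memory cells \<open>0, 1, \<dots>\<close>, with its length in register \<open>0\<close>;
  all other registers and cells are initially zero.\<close>

definition input_state :: "int list \<Rightarrow> ram_state" where
  "input_state w =
     \<lparr>reg = (\<lambda>r. if r = 0 then int (length w) else 0),
      mem = (\<lambda>a. if 0 \<le> a \<and> a < int (length w) then w ! nat a else 0)\<rparr>"

definition output_word :: "ram_state \<Rightarrow> int list" where
  "output_word s = map (mem s) [0..reg s 0 - 1]"

definition word_size :: "int list \<Rightarrow> nat" where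
  "word_size w = (\<Sum>z\<leftarrow>w. 1 + int_size z)"

text \<open>A problem is given by its valid instances, their encoding, and the acceptable output words
  for each instance. The size of the output word is charged as well, because setting the length
  register alone would otherwise produce arbitrarily long words of zeros for free.\<close>

definition poly_time_solvable ::
  "('i \<Rightarrow> bool) \<Rightarrow> ('i \<Rightarrow> int list) \<Rightarrow> ('i \<Rightarrow> int list \<Rightarrow> bool) \<Rightarrow> bool" where
  "poly_time_solvable valid encode acceptable \<longleftrightarrow>
     (\<exists>(c :: program) (q :: nat poly). \<forall>I. valid I \<longrightarrow>
        (\<exists>t s. run c (input_state (encode I)) t s
           \<and> t + word_size (output_word s) \<le> poly q (word_size (encode I))
           \<and> acceptable I (output_word s)))"


section \<open>Two-stage robust selection\<close>

text \<open>Vectors indexed by \<open>[n]\<close> are functions on \<open>{1..n}\<close>; the values of the cost functions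
  elsewhere are irrelevant. All input numbers are rational.\<close>

record r2st_instance =
  items :: nat
  quota :: nat
  first_cost :: "nat \<Rightarrow> rat"
  lower_cost :: "nat \<Rightarrow> rat"
  upper_cost :: "nat \<Rightarrow> rat"
  budget :: rat

definition valid_r2st :: "r2st_instance \<Rightarrow> bool" where
  "valid_r2st I \<longleftrightarrow> quota I \<in> {1..items I}
     \<and> (\<forall>i\<in>{1..items I}. 0 \<le> lower_cost I i \<and> lower_cost I i \<le> upper_cost I i)
     \<and> 0 \<le> budget I"

definition encode_rat :: "rat \<Rightarrow> int list" where
  "encode_rat r = [fst (quotient_of r), snd (quotient_of r)]"

definition encode_r2st :: "r2st_instance \<Rightarrow> int list" where
  "encode_r2st I = [int (items I), int (quota I)] @ encode_rat (budget I)
     @ concat (map (\<lambda>i. encode_rat (first_cost I i) @ encode_rat (lower_cost I i)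
                        @ encode_rat (upper_cost I i)) [1..<items I + 1])"

definition first_stage :: "r2st_instance \<Rightarrow> (nat \<Rightarrow> nat) set" where
  "first_stage I = {x \<in> {1..items I} \<rightarrow>\<^sub>E {0, 1}. (\<Sum>i\<in>{1..items I}. x i) \<le> quota I}"

definition second_stage :: "r2st_instance \<Rightarrow> (nat \<Rightarrow> nat) \<Rightarrow> (nat \<Rightarrow> nat) set" where
  "second_stage I x = {y \<in> {1..items I} \<rightarrow>\<^sub>E {0, 1}.
     (\<Sum>i\<in>{1..items I}. x i + y i) = quota I \<and> (\<forall>i\<in>{1..items I}. x i + y i \<le> 1)}"

definition deviation :: "r2st_instance \<Rightarrow> nat \<Rightarrow> rat" where
  "deviation I i = upper_cost I i - lower_cost I i"

definition continuous_scenarios :: "r2st_instance \<Rightarrow> (nat \<Rightarrow> real) set" where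
  "continuous_scenarios I =
     {\<lambda>i\<in>{1..items I}. of_rat (lower_cost I i) + \<delta> i | \<delta>.
        (\<forall>i\<in>{1..items I}. \<delta> i \<in> {0..of_rat (deviation I i)})
        \<and> (\<Sum>i\<in>{1..items I}. \<delta> i) \<le> of_rat (budget I)}"

definition cost :: "r2st_instance \<Rightarrow> (nat \<Rightarrow> real) \<Rightarrow> (nat \<Rightarrow> nat) \<Rightarrow> real" where
  "cost I c y = (\<Sum>i\<in>{1..items I}. c i * real (y i))"

definition recourse_cost :: "r2st_instance \<Rightarrow> (nat \<Rightarrow> nat) \<Rightarrow> (nat \<Rightarrow> real) \<Rightarrow> real" where
  "recourse_cost I x c = Min (cost I c ` second_stage I x)"

text \<open>The scenario set is infinite; \<open>GREATEST\<close> denotes a maximum that has to be attained.\<close>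

definition robust_cost :: "r2st_instance \<Rightarrow> (nat \<Rightarrow> nat) \<Rightarrow> real" where
  "robust_cost I x = cost I (\<lambda>i. of_rat (first_cost I i)) x
     + (GREATEST v. v \<in> recourse_cost I x ` continuous_scenarios I)"

definition optimal_value :: "r2st_instance \<Rightarrow> real" where
  "optimal_value I = Min (robust_cost I ` first_stage I)"

text \<open>An output word lists the entries of an optimal first-stage solution, followed by numerator
  and denominator (not necessarily coprime) of the optimal value.\<close>

definition solves_r2st :: "r2st_instance \<Rightarrow> int list \<Rightarrow> bool" where
  "solves_r2st I w \<longleftrightarrow>
     (\<exists>x a b. w = map (\<lambda>i. int (x i)) [1..<items I + 1] @ [a, b]
        \<and> x \<in> first_stage I \<and> robust_cost I x = optimal_value I
        \<and> b > 0 \<and> optimal_value I = of_int a / of_int b)"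

end

theory Submission
  imports Defs
begin

text \<open>
  For a fixed first stage and a fixed threshold separating selected from unselected items, the adversary
  lifts the lower costs to the threshold. The resulting maximum is dual to minimising, over a multiplier
  \<open>\<lambda> \<in> [0, 1]\<close> for the budget, \<open>\<lambda> \<Gamma>\<close> plus the cost of a fractional selection in which every item is split
  into a piece of length \<open>\<lambda>\<close> at its lower cost and a piece of length \<open>1 - \<lambda>\<close> at its upper cost. An optimal
  \<open>\<lambda>\<close> equates the number of selected pieces with the number of open places, so it is a fraction \<open>j / q\<close>
  with \<open>q \<le> n\<close>, and then no piece has to be split. After multiplying lengths by \<open>q\<close>, minimising over the
  first stage as well is, for each of the quadratically many pairs \<open>(q, j)\<close>, a knapsack problem of
  capacity \<open>p q\<close> with four choices per item, which dynamic programming solves in polynomial time.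
\<close>

section \<open>Cost of programs\<close>

text \<open>No general duality theorem is invoked. Weak duality is an item-by-item comparison.
  Strong duality is exhibited: the adversary raises low costs to a common level
  \<open>\<alpha>\<close>, continuity yields the level at which the budget is spent exactly, and the
  items caught strictly between their two costs determine the fraction, \<open>q\<close> being their
  number and \<open>j\<close> the number of them that are still selected. The program has to return
  a first stage and not only a value. Instead of storing choices and backtracking, the maximised
  number carries the first-stage bits in its low digits, so one division with remainder separates
  value and solution. Dynamic programming naturally bounds the used capacity from above, whereas a
  dual solution must use it exactly; a large reward per unit closes this gap without undefined table
  entries. Pairs with different \<open>q\<close> give values with different denominators, so they
  are compared after cross multiplication. Under logarithmic cost the number of steps is not enough:
  one bit bound, linear in the input size, is kept for all states of the run.\<close>

definition bounded :: "nat \<Rightarrow> ram_state \<Rightarrow> bool" where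
  "bounded L s \<longleftrightarrow> (\<forall>r. \<bar>reg s r\<bar> < 2 ^ L) \<and> (\<forall>a. \<bar>mem s a\<bar> < 2 ^ L)"

lemma bounded_set_reg: "bounded L s \<Longrightarrow> \<bar>v\<bar> < 2 ^ L \<Longrightarrow> bounded L (s\<lparr>reg := (reg s)(r := v)\<rparr>)"
  by (simp add: bounded_def)

lemma bounded_set_mem: "bounded L s \<Longrightarrow> \<bar>v\<bar> < 2 ^ L \<Longrightarrow> bounded L (s\<lparr>mem := (mem s)(a := v)\<rparr>)"
  by (simp add: bounded_def)

lemma int_size_le_iff: "int_size z \<le> Suc k \<longleftrightarrow> \<bar>z\<bar> < 2 ^ k"
proof -
  have "int_size z \<le> Suc k \<longleftrightarrow> nat \<bar>z\<bar> < 2 ^ k"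
    by (simp add: int_size_def floorlog_le_iff)
  also have "\<dots> \<longleftrightarrow> \<bar>z\<bar> < 2 ^ k"
    by (metis nat_less_numeral_power_cancel_iff)
  finally show ?thesis .
qed

lemma int_size_le: "\<bar>z\<bar> < 2 ^ k \<Longrightarrow> int_size z \<le> Suc k"
  by (simp add: int_size_le_iff)

lemma int_size_pos: "0 < int_size z"
  by (simp add: int_size_def)

lemma abs_less_two_power_int_size: "\<bar>z\<bar> < 2 ^ (int_size z - 1)"
  using int_size_le_iff[of z "int_size z - 1"] int_size_pos[of z] by simp

text \<open>In a state whose entries have at most \<open>L\<close> bits, an expression has at most
  \<open>bits_factor e * L\<close> bits.\<close>

primrec bits_factor :: "expr \<Rightarrow> nat" where
  "bits_factor (Const k) = int_size k"
| "bits_factor (Reg r) = 1"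
| "bits_factor (Mem e) = 1"
| "bits_factor (Plus a b) = bits_factor a + bits_factor b"
| "bits_factor (Minus a b) = bits_factor a + bits_factor b"
| "bits_factor (Times a b) = bits_factor a + bits_factor b"
| "bits_factor (Div a b) = bits_factor a"

primrec expr_factor :: "expr \<Rightarrow> nat" where
  "expr_factor (Const k) = 1 + bits_factor (Const k)"
| "expr_factor (Reg r) = 1 + bits_factor (Reg r)"
| "expr_factor (Mem e) = expr_factor e + 1 + bits_factor (Mem e)"
| "expr_factor (Plus a b) = expr_factor a + expr_factor b + 1 + bits_factor (Plus a b)"
| "expr_factor (Minus a b) = expr_factor a + expr_factor b + 1 + bits_factor (Minus a b)"
| "expr_factor (Times a b) = expr_factor a + expr_factor b + 1 + bits_factor (Times a b)"
| "expr_factor (Div a b) = expr_factor a + expr_factor b + 1 + bits_factor (Div a b)"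

lemma bits_factor_pos: "0 < bits_factor e"
  by (induction e) (auto simp: int_size_pos)

text \<open>For positive exponents \<open>(2 ^ a - 1) * (2 ^ b - 1) \<ge> 1\<close>, which expands
  to the claim. Sums and differences can thus be charged like products, by adding the factors of the
  operands.\<close>

lemma power_add_le_power_sum:
  assumes "0 < a" "0 < b"
  shows "(2::int) ^ a + 2 ^ b \<le> 2 ^ (a + b)"
proof -
  have "(2::int) \<le> 2 ^ a" "(2::int) \<le> 2 ^ b"
    using assms by (simp_all add: self_le_power)
  then have "0 \<le> ((2::int) ^ a - 1) * (2 ^ b - 1) - 1"
    using mult_mono[of 1 "(2::int) ^ a - 1" 1 "2 ^ b - 1"] by simp
  then show ?thesis
    by (simp add: algebra_simps power_add)
qed

text \<open>Division rounds down, so the delicate case is a negative \<open>x\<close>: there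
  \<open>x * y \<le> x\<close> for \<open>y \<ge> 1\<close> keeps the quotient from falling below
  \<open>x\<close>. A negative divisor is handled by negating both arguments.\<close>

lemma abs_div_le_abs: "\<bar>x div y\<bar> \<le> \<bar>x\<bar>" for x y :: int
proof -
  have pos: "\<bar>x div y\<bar> \<le> \<bar>x\<bar>" if "y > 0" for x y :: int
  proof (cases "x \<ge> 0")
    case True
    then show ?thesis
      using that zdiv_mono2[of x 1 y] by (simp add: pos_imp_zdiv_nonneg_iff)
  next
    case False
    then have "x * y \<le> x * 1"
      using that by (intro mult_left_mono_neg) auto
    then have "x * y div y \<le> x div y"
      using that by (intro zdiv_mono1) auto
    moreover have "x div y < 0"
      using False that by (simp add: pos_imp_zdiv_neg_iff)
    ultimately show ?thesis
      using that by simp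
  qed
  show ?thesis
    using pos[of y x] pos[of "- y" "- x"] by (cases "y = 0") (auto simp: neq_iff)
qed

context
  fixes s :: ram_state and L :: nat
  assumes L: "1 \<le> L" and s: "bounded L s"
begin

lemma abs_eval_expr_less: "\<bar>eval_expr e s\<bar> < 2 ^ (bits_factor e * L)"
proof (induction e)
  case (Const k)
  have "int_size k - 1 \<le> int_size k * L"
    using L by (metis diff_le_self le_trans mult_le_mono2 nat_mult_1_right)
  then have "(2::int) ^ (int_size k - 1) \<le> 2 ^ (int_size k * L)"
    by (simp add: power_increasing)
  then show ?case
    using abs_less_two_power_int_size[of k] by (simp only: eval_expr.simps bits_factor.simps)
next
  case (Plus a b)
  then show ?case
    using power_add_le_power_sum[of "bits_factor a * L" "bits_factor b * L"]
      bits_factor_pos[of a] bits_factor_pos[of b] L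
    by (simp add: add_mult_distrib)
next
  case (Minus a b)
  then show ?case
    using power_add_le_power_sum[of "bits_factor a * L" "bits_factor b * L"]
      bits_factor_pos[of a] bits_factor_pos[of b] L
    by (simp add: add_mult_distrib)
next
  case (Times a b)
  then show ?case
    by (simp add: add_mult_distrib power_add abs_mult mult_strict_mono')
next
  case (Div a b)
  then show ?case
    using abs_div_le_abs[of "eval_expr a s" "eval_expr b s"] by simp
qed (use s in \<open>simp_all add: bounded_def\<close>)

lemma int_size_eval_expr_le: "int_size (eval_expr e s) \<le> (1 + bits_factor e) * L"
  using int_size_le[OF abs_eval_expr_less[of e]] L by simp

lemma expr_cost_le: "expr_cost e s \<le> expr_factor e * L"
proof (induction e)
  case (Const k)
  then show ?case using int_size_eval_expr_le[of "Const k"] by simp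
next
  case (Reg r)
  then show ?case using int_size_eval_expr_le[of "Reg r"] by simp
next
  case (Mem e)
  then show ?case using int_size_eval_expr_le[of "Mem e"] by (simp add: algebra_simps)
next
  case (Plus a b)
  then show ?case using int_size_eval_expr_le[of "Plus a b"] by (simp add: algebra_simps)
next
  case (Minus a b)
  then show ?case using int_size_eval_expr_le[of "Minus a b"] by (simp add: algebra_simps)
next
  case (Times a b)
  then show ?case using int_size_eval_expr_le[of "Times a b"] by (simp add: algebra_simps)
next
  case (Div a b)
  then show ?case using int_size_eval_expr_le[of "Div a b"] by (simp add: algebra_simps)
qed

end

text \<open>A program all of whose loops make at most \<open>X\<close> iterations, on entries of at most \<open>L\<close> bits,
  costs at most \<open>poly (cost_poly c) X * L\<close>.\<close>

primrec cost_poly :: "program \<Rightarrow> nat poly" where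
  "cost_poly Skip = 1"
| "cost_poly (Assign r e) = [:1 + expr_factor e:]"
| "cost_poly (Store a e) = [:1 + expr_factor a + expr_factor e:]"
| "cost_poly (Seq c1 c2) = cost_poly c1 + cost_poly c2"
| "cost_poly (IfPos b c1 c2) = [:1 + expr_factor b:] + cost_poly c1 + cost_poly c2"
| "cost_poly (WhilePos b c) = [:1 + expr_factor b, 1 + expr_factor b:] + [:0, 1:] * cost_poly c"

text \<open>Boundedness is both premise and conclusion inside the predicate, so the rules compose
  without carrying it along, and a proof about a program only checks the size of each value it
  writes. \<open>X\<close> and \<open>L\<close> stay fixed for a whole run, which keeps nested loops
  from compounding bit lengths.\<close>

definition wp :: "nat \<Rightarrow> nat \<Rightarrow> program \<Rightarrow> (ram_state \<Rightarrow> bool) \<Rightarrow> ram_state \<Rightarrow> bool" where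
  "wp X L c Q s \<longleftrightarrow> 1 \<le> L \<and> bounded L s \<longrightarrow>
     (\<exists>t s'. run c s t s' \<and> t \<le> poly (cost_poly c) X * L \<and> bounded L s' \<and> Q s')"

lemma wp_mono: "wp X L c Q s \<Longrightarrow> (\<And>s'. Q s' \<Longrightarrow> R s') \<Longrightarrow> wp X L c R s"
  unfolding wp_def by blast

lemma wp_Skip: "Q s \<Longrightarrow> wp X L Skip Q s"
  unfolding wp_def using run.Skip by fastforce

lemma wp_Assign:
  assumes "\<bar>eval_expr e s\<bar> < 2 ^ L" "Q (s\<lparr>reg := (reg s)(r := eval_expr e s)\<rparr>)"
  shows "wp X L (Assign r e) Q s"
  unfolding wp_def
proof (intro impI exI conjI)
  assume *: "1 \<le> L \<and> bounded L s"
  then show "1 + expr_cost e s \<le> poly (cost_poly (Assign r e)) X * L"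
    using expr_cost_le[of L s e] by simp
  show "bounded L (s\<lparr>reg := (reg s)(r := eval_expr e s)\<rparr>)"
    using bounded_set_reg * assms by blast
qed (use assms run.Assign in auto)

lemma wp_Store:
  assumes "\<bar>eval_expr e s\<bar> < 2 ^ L" "Q (s\<lparr>mem := (mem s)(eval_expr a s := eval_expr e s)\<rparr>)"
  shows "wp X L (Store a e) Q s"
  unfolding wp_def
proof (intro impI exI conjI)
  assume *: "1 \<le> L \<and> bounded L s"
  then show "1 + expr_cost a s + expr_cost e s \<le> poly (cost_poly (Store a e)) X * L"
    using expr_cost_le[of L s a] expr_cost_le[of L s e] by (simp add: algebra_simps)
  show "bounded L (s\<lparr>mem := (mem s)(eval_expr a s := eval_expr e s)\<rparr>)"
    using bounded_set_mem * assms by blast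
qed (use assms run.Store in auto)

lemma wp_Seq:
  assumes "wp X L c1 (wp X L c2 Q) s"
  shows "wp X L (Seq c1 c2) Q s"
  unfolding wp_def
proof
  assume *: "1 \<le> L \<and> bounded L s"
  then obtain t1 s1 where 1: "run c1 s t1 s1" "t1 \<le> poly (cost_poly c1) X * L" "bounded L s1"
      "wp X L c2 Q s1"
    using assms unfolding wp_def by blast
  then obtain t2 s2 where 2: "run c2 s1 t2 s2" "t2 \<le> poly (cost_poly c2) X * L" "bounded L s2" "Q s2"
    using * unfolding wp_def by blast
  have "t1 + t2 \<le> poly (cost_poly (Seq c1 c2)) X * L"
    using 1 2 by (simp add: algebra_simps)
  then show "\<exists>t s'. run (Seq c1 c2) s t s' \<and> t \<le> poly (cost_poly (Seq c1 c2)) X * L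
      \<and> bounded L s' \<and> Q s'"
    using run.Seq[OF 1(1) 2(1)] 2 by blast
qed

lemma wp_IfPos:
  assumes "eval_expr b s > 0 \<Longrightarrow> wp X L c1 Q s" "\<not> eval_expr b s > 0 \<Longrightarrow> wp X L c2 Q s"
  shows "wp X L (IfPos b c1 c2) Q s"
  unfolding wp_def
proof
  assume *: "1 \<le> L \<and> bounded L s"
  show "\<exists>t s'. run (IfPos b c1 c2) s t s' \<and> t \<le> poly (cost_poly (IfPos b c1 c2)) X * L
      \<and> bounded L s' \<and> Q s'"
  proof (cases "eval_expr b s > 0")
    case True
    then obtain t s' where 1: "run c1 s t s'" "t \<le> poly (cost_poly c1) X * L" "bounded L s'" "Q s'"
      using assms(1) * unfolding wp_def by blast
    have "1 + expr_cost b s + t \<le> poly (cost_poly (IfPos b c1 c2)) X * L"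
      using 1 * expr_cost_le[of L s b] by (simp add: algebra_simps)
    then show ?thesis using run.IfTrue[OF True 1(1)] 1 by blast
  next
    case False
    then obtain t s' where 1: "run c2 s t s'" "t \<le> poly (cost_poly c2) X * L" "bounded L s'" "Q s'"
      using assms(2) * unfolding wp_def by blast
    have "1 + expr_cost b s + t \<le> poly (cost_poly (IfPos b c1 c2)) X * L"
      using 1 * expr_cost_le[of L s b] by (simp add: algebra_simps)
    then show ?thesis using run.IfFalse[OF False 1(1)] 1 by blast
  qed
qed

text \<open>The invariant is indexed by the number of completed iterations and determines the guard,
  so \<open>N\<close> is the exact iteration count and termination comes for free.\<close>

lemma wp_WhilePos:
  assumes "N \<le> X" and init: "Inv 0 s"
    and body: "\<And>i s. i < N \<Longrightarrow> Inv i s \<Longrightarrow> eval_expr b s > 0 \<and> wp X L c (Inv (Suc i)) s"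
    and exit: "\<And>s. Inv N s \<Longrightarrow> \<not> eval_expr b s > 0 \<and> Q s"
  shows "wp X L (WhilePos b c) Q s"
  unfolding wp_def
proof
  assume *: "1 \<le> L \<and> bounded L s"
  define B where "B = (1 + expr_factor b) * L"
  define E where "E = poly (cost_poly c) X * L"
  have guard: "1 + expr_cost b s \<le> B" if "bounded L s" for s
    using that * expr_cost_le[of L s b] by (simp add: B_def)
  \<comment> \<open>Induction on the number \<open>k\<close> of iterations still to come:
    \<open>B\<close> pays for one guard test, \<open>E\<close> for one execution of the
    body.\<close>
  have "\<exists>t s'. run (WhilePos b c) s t s' \<and> t \<le> (k + 1) * B + k * E \<and> bounded L s' \<and> Q s'"
    if "bounded L s" "Inv (N - k) s" "k \<le> N" for k s
    using that
  proof (induction k arbitrary: s)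
    case 0
    then have "run (WhilePos b c) s (1 + expr_cost b s) s" "Q s"
      using exit run.WhileFalse by auto
    then show ?case using guard 0 by fastforce
  next
    case (Suc k)
    then have g: "eval_expr b s > 0" and "wp X L c (Inv (N - k)) s"
      using body[of "N - Suc k" s] Suc_diff_Suc[of k N] by auto
    then obtain t1 s1 where 1: "run c s t1 s1" "t1 \<le> E" "bounded L s1" "Inv (N - k) s1"
      using Suc.prems * unfolding wp_def E_def by blast
    then obtain t2 s2 where 2: "run (WhilePos b c) s1 t2 s2" "t2 \<le> (k + 1) * B + k * E"
        "bounded L s2" "Q s2"
      using Suc.IH[of s1] Suc.prems by auto
    have "1 + expr_cost b s + t1 + t2 \<le> (Suc k + 1) * B + Suc k * E"
      using 1 2 guard[OF Suc.prems(1)] by simp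
    then show ?case using run.WhileTrue[OF g 1(1) 2(1)] 2 by blast
  qed
  from this[of s N] * init obtain t s' where
    r: "run (WhilePos b c) s t s'" "t \<le> (N + 1) * B + N * E" "bounded L s'" "Q s'"
    by auto
  note r(2)
  also have "(N + 1) * B + N * E \<le> (X + 1) * B + X * E"
    using \<open>N \<le> X\<close> by (intro add_mono mult_le_mono1) auto
  also have "\<dots> = poly (cost_poly (WhilePos b c)) X * L"
    by (simp add: B_def E_def algebra_simps)
  finally show "\<exists>t s'. run (WhilePos b c) s t s' \<and> t \<le> poly (cost_poly (WhilePos b c)) X * L
      \<and> bounded L s' \<and> Q s'"
    using r by blast
qed

lemma word_size_output_le:
  assumes "bounded L s" "reg s 0 \<le> int m"
  shows "word_size (output_word s) \<le> m * (L + 2)"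
proof -
  have "word_size (output_word s) = (\<Sum>a\<leftarrow>[0..reg s 0 - 1]. 1 + int_size (mem s a))"
    by (simp add: word_size_def output_word_def comp_def)
  \<comment> \<open>The \<open>2\<close> is one unit per word entry plus the constant unit in
    \<open>int_size\<close>.\<close>
  also have "\<dots> \<le> (\<Sum>a\<leftarrow>[0..reg s 0 - 1]. L + 2)"
    using assms(1) int_size_le by (intro sum_list_mono) (fastforce simp: bounded_def)
  also have "\<dots> = nat (reg s 0) * (L + 2)"
    by (simp add: sum_list_triv)
  also have "\<dots> \<le> m * (L + 2)"
    using assms(2) by (intro mult_le_mono1) simp
  finally show ?thesis .
qed

section \<open>Fractional selection\<close>

declare One_nat_def [simp del]

text \<open>Greedy growth: adjoin a minimiser of the remainder. The threshold is the value at an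
  element of \<open>Y\<close> itself, which later shows that this element drops out at a strictly
  smaller level.\<close>

lemma obtain_smallest_subset:
  fixes g :: "'a \<Rightarrow> 'b::linorder"
  assumes "finite N" "1 \<le> m" "m \<le> card N"
  obtains Y a where "Y \<subseteq> N" "card Y = m" "a \<in> Y" "\<forall>i\<in>Y. g i \<le> g a" "\<forall>i\<in>N - Y. g a \<le> g i"
proof -
  have "\<exists>Y a. Y \<subseteq> N \<and> card Y = m \<and> a \<in> Y \<and> (\<forall>i\<in>Y. g i \<le> g a) \<and> (\<forall>i\<in>N - Y. g a \<le> g i)"
    using assms(2,3)
  proof (induction m rule: nat_induct_at_least)
    case base
    then have "N \<noteq> {}" by auto
    with assms(1) obtain a where "is_arg_min g (\<lambda>i. i \<in> N) a"
      using ex_is_arg_min_if_finite[of N g] by blast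
    then show ?case
      by (intro exI[of _ "{a}"] exI[of _ a]) (auto simp: is_arg_min_linorder)
  next
    case (Suc m)
    then obtain Y a where Y: "Y \<subseteq> N" "card Y = m" "a \<in> Y" "\<forall>i\<in>Y. g i \<le> g a" "\<forall>i\<in>N - Y. g a \<le> g i"
      by auto
    have "finite Y" using Y(1) assms(1) finite_subset by blast
    have "N - Y \<noteq> {}" using Y Suc.prems \<open>finite Y\<close> by auto
    with assms(1) obtain b where "is_arg_min g (\<lambda>i. i \<in> N - Y) b"
      using ex_is_arg_min_if_finite[of "N - Y" g] by blast
    then have b: "b \<in> N - Y" "\<forall>i\<in>N - Y. g b \<le> g i"
      by (auto simp: is_arg_min_linorder)
    have "g a \<le> g b" using Y(5) b(1) by blast
    then have "\<forall>i\<in>insert b Y. g i \<le> g b" using Y(4) by force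
    moreover have "card (insert b Y) = Suc m" using Y(2) b(1) \<open>finite Y\<close> by simp
    ultimately show ?case
      using Y(1) b by (intro exI[of _ "insert b Y"] exI[of _ b]) blast
  qed
  with that show thesis by blast
qed

text \<open>An exchange argument: the weight \<open>1 - u i\<close> missing on \<open>Y\<close>
  costs at most \<open>\<alpha>\<close> per unit, and the same total weight outside \<open>Y\<close>
  costs at least \<open>\<alpha>\<close> per unit.\<close>

lemma selection_le_fractional:
  fixes c u :: "'a \<Rightarrow> real"
  assumes "finite N" "Y \<subseteq> N" "\<forall>i\<in>Y. c i \<le> \<alpha>" "\<forall>i\<in>N - Y. \<alpha> \<le> c i"
    and "\<forall>i\<in>N. 0 \<le> u i \<and> u i \<le> 1" "sum u N = real (card Y)"
  shows "sum c Y \<le> (\<Sum>i\<in>N. c i * u i)"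
proof -
  have "finite Y" using assms finite_subset by blast
  have split: "sum h N = sum h Y + sum h (N - Y)" for h :: "'a \<Rightarrow> real"
    using assms(1,2) by (metis add.commute sum.subset_diff)
  have "(\<Sum>i\<in>N - Y. \<alpha> * u i) \<le> (\<Sum>i\<in>N - Y. c i * u i)"
    using assms by (intro sum_mono mult_right_mono) auto
  moreover have "(\<Sum>i\<in>Y. c i * (1 - u i)) \<le> (\<Sum>i\<in>Y. \<alpha> * (1 - u i))"
    using assms by (intro sum_mono mult_right_mono) auto
  moreover have "(\<Sum>i\<in>N - Y. \<alpha> * u i) = (\<Sum>i\<in>Y. \<alpha> * (1 - u i))"
  proof -
    have "\<alpha> * sum u (N - Y) = \<alpha> * (real (card Y) - sum u Y)"
      using assms(6) split[of u] by simp
    then show ?thesis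
      by (simp add: right_diff_distrib sum_subtractf flip: sum_distrib_left)
  qed
  ultimately show ?thesis
    using split[of "\<lambda>i. c i * u i"] by (simp add: right_diff_distrib sum_subtractf)
qed

section \<open>Patterns\<close>

text \<open>The lengths \<open>amount q j\<close> are \<open>q\<close> times those of the dual problem with \<open>\<lambda> = j / q\<close>; an item with
  choice \<open>Partial\<close> contributes only its piece at the lower cost.\<close>

datatype choice = Unused | Partial | Recourse | First

primrec amount :: "nat \<Rightarrow> nat \<Rightarrow> choice \<Rightarrow> nat" where
  "amount q j Unused = 0"
| "amount q j Partial = j"
| "amount q j Recourse = q"
| "amount q j First = q"

text \<open>Polymorphic because the same formula is used for real costs in
  \<open>pattern_value\<close> and for scaled integers in the program. Hence \<open>q - j\<close> is
  taken in the ring and not on naturals.\<close>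

primrec price :: "nat \<Rightarrow> nat \<Rightarrow> 'a \<Rightarrow> 'a \<Rightarrow> 'a \<Rightarrow> choice \<Rightarrow> 'a::comm_ring_1" where
  "price q j C l h Unused = 0"
| "price q j C l h Partial = of_nat j * l"
| "price q j C l h Recourse = of_nat j * l + (of_nat q - of_nat j) * h"
| "price q j C l h First = of_nat q * C"

definition pattern :: "r2st_instance \<Rightarrow> nat \<Rightarrow> nat \<Rightarrow> (nat \<Rightarrow> choice) \<Rightarrow> bool" where
  "pattern I q j f \<longleftrightarrow> 1 \<le> q \<and> j \<le> q \<and> (\<Sum>i\<in>{1..items I}. amount q j (f i)) = quota I * q"

definition pattern_value :: "r2st_instance \<Rightarrow> nat \<Rightarrow> nat \<Rightarrow> (nat \<Rightarrow> choice) \<Rightarrow> real" where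
  "pattern_value I q j f =
     ((\<Sum>i\<in>{1..items I}. price q j (of_rat (first_cost I i)) (of_rat (lower_cost I i))
          (of_rat (upper_cost I i)) (f i)) + real j * of_rat (budget I)) / real q"

definition first_items :: "r2st_instance \<Rightarrow> (nat \<Rightarrow> choice) \<Rightarrow> nat \<Rightarrow> nat" where
  "first_items I f = (\<lambda>i\<in>{1..items I}. if f i = First then 1 else 0)"

lemma first_items_in_first_stage:
  assumes "pattern I q j f"
  shows "first_items I f \<in> first_stage I"
proof -
  have "(\<Sum>i\<in>{1..items I}. first_items I f i) * q = (\<Sum>i\<in>{1..items I}. first_items I f i * q)"
    by (rule sum_distrib_right)
  also have "\<dots> \<le> (\<Sum>i\<in>{1..items I}. amount q j (f i))"
    by (intro sum_mono) (auto simp: first_items_def)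
  finally have "(\<Sum>i\<in>{1..items I}. first_items I f i) * q \<le> quota I * q"
    using assms by (simp add: pattern_def)
  then have "(\<Sum>i\<in>{1..items I}. first_items I f i) \<le> quota I"
    using assms by (simp add: pattern_def)
  then show ?thesis
    by (auto simp: first_stage_def first_items_def)
qed

section \<open>Duality for a fixed first stage\<close>

locale first_stage_solution =
  fixes I :: r2st_instance and x :: "nat \<Rightarrow> nat"
  assumes valid: "valid_r2st I" and x: "x \<in> first_stage I"
begin

definition "rest = {i \<in> {1..items I}. x i = 0}"
definition "open_quota = quota I - (\<Sum>i\<in>{1..items I}. x i)"
definition "lo i = real_of_rat (lower_cost I i)"
definition "hi i = real_of_rat (upper_cost I i)"

lemma x_cases: "i \<in> {1..items I} \<Longrightarrow> x i = 0 \<or> x i = 1"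
  using x by (auto simp: first_stage_def PiE_iff)

lemma lo_hi: "i \<in> {1..items I} \<Longrightarrow> 0 \<le> lo i \<and> lo i \<le> hi i"
  using valid by (auto simp: valid_r2st_def lo_def hi_def of_rat_less_eq)

lemma finite_rest: "finite rest"
  by (simp add: rest_def)

lemma rest_subset: "rest \<subseteq> {1..items I}"
  by (auto simp: rest_def)

lemma rest_iff: "i \<in> rest \<longleftrightarrow> i \<in> {1..items I} \<and> x i \<noteq> 1"
  using x_cases[of i] by (auto simp: rest_def)

lemma sum_x_le_quota: "(\<Sum>i\<in>{1..items I}. x i) \<le> quota I"
  using x by (simp add: first_stage_def)

lemma sum_x: "(\<Sum>i\<in>{1..items I}. x i) = card {i \<in> {1..items I}. x i = 1}"
proof -
  have "(\<Sum>i\<in>{1..items I}. x i) = (\<Sum>i\<in>{1..items I}. if x i = 1 then 1 else 0)"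
    using x_cases by (intro sum.cong) fastforce+
  then show ?thesis by (simp add: sum.If_cases Int_def conj_commute)
qed

lemma open_quota_le_card_rest: "open_quota \<le> card rest"
proof -
  have "{1..items I} = rest \<union> {i \<in> {1..items I}. x i = 1}"
    by (auto simp: rest_iff)
  moreover have "rest \<inter> {i \<in> {1..items I}. x i = 1} = {}"
    by (auto simp: rest_def)
  ultimately have "card {1..items I} = card rest + card {i \<in> {1..items I}. x i = 1}"
    by (metis (no_types, lifting) card_Un_disjoint finite_Un finite_atLeastAtMost)
  then show ?thesis
    using valid by (auto simp: sum_x open_quota_def valid_r2st_def)
qed

lemma finite_second_stage: "finite (second_stage I x)"
  by (rule finite_subset[of _ "{1..items I} \<rightarrow>\<^sub>E {0, 1}"]) (auto simp: second_stage_def intro!: finite_PiE)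

lemma sum_restrict_rest:
  fixes h :: "nat \<Rightarrow> 'b::comm_monoid_add"
  assumes "\<And>i. i \<in> {1..items I} \<Longrightarrow> i \<notin> rest \<Longrightarrow> h i = 0"
  shows "sum h {1..items I} = sum h rest"
  using assms rest_subset by (intro sum.mono_neutral_right) auto

definition selection :: "nat set \<Rightarrow> nat \<Rightarrow> nat" where
  "selection Y = (\<lambda>i\<in>{1..items I}. if i \<in> Y then 1 else 0)"

lemma sum_selection:
  assumes "Y \<subseteq> rest"
  shows "(\<Sum>i\<in>{1..items I}. h i * real (selection Y i)) = sum h Y"
proof -
  have "(\<Sum>i\<in>{1..items I}. h i * real (selection Y i)) = (\<Sum>i\<in>{1..items I}. if i \<in> Y then h i else 0)"
    by (intro sum.cong) (auto simp: selection_def)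
  also have "\<dots> = sum h ({1..items I} \<inter> Y)"
    by (simp add: sum.inter_restrict)
  also have "{1..items I} \<inter> Y = Y" using assms rest_subset by blast
  finally show ?thesis .
qed

lemma selection_in_second_stage:
  assumes "Y \<subseteq> rest" "card Y = open_quota"
  shows "selection Y \<in> second_stage I x"
proof -
  have "real (\<Sum>i\<in>{1..items I}. selection Y i) = real (card Y)"
    using sum_selection[OF assms(1), of "\<lambda>_. 1"] by simp
  then have "(\<Sum>i\<in>{1..items I}. selection Y i) = card Y"
    by (simp only: of_nat_eq_iff)
  then have "(\<Sum>i\<in>{1..items I}. x i + selection Y i) = quota I"
    using assms(2) sum_x_le_quota by (simp add: sum.distrib open_quota_def)
  moreover have "x i + selection Y i \<le> 1" if "i \<in> {1..items I}" for i
    using x_cases[OF that] assms(1) that by (auto simp: selection_def rest_def)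
  moreover have "selection Y \<in> {1..items I} \<rightarrow>\<^sub>E {0, 1}"
    by (auto simp: selection_def)
  ultimately show ?thesis
    by (simp only: second_stage_def mem_Collect_eq) blast
qed

lemma recourse_cost_le_fractional:
  assumes u: "\<forall>i\<in>rest. 0 \<le> u i \<and> u i \<le> 1" "sum u rest = real open_quota"
  shows "recourse_cost I x c \<le> (\<Sum>i\<in>rest. c i * u i)"
proof -
  obtain Y \<alpha> where Y: "Y \<subseteq> rest" "card Y = open_quota" "\<forall>i\<in>Y. c i \<le> \<alpha>" "\<forall>i\<in>rest - Y. \<alpha> \<le> c i"
  proof (cases "open_quota = 0")
    case True
    then show thesis
      \<comment> \<open>With nothing to select, the threshold only has to lie below all remaining
        costs. If \<open>rest\<close> is empty, \<open>Min\<close> is unspecified but there is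
        nothing to check.\<close>
      using that[of "{}" "Min (c ` rest)"] finite_rest by simp
  next
    case False
    then show thesis
      using obtain_smallest_subset[of rest open_quota c] finite_rest open_quota_le_card_rest that
      by (metis One_nat_def Suc_leI gr0I)
  qed
  have "recourse_cost I x c \<le> cost I c (selection Y)"
    unfolding recourse_cost_def using finite_second_stage selection_in_second_stage[OF Y(1,2)]
    by (intro Min_le) auto
  also have "\<dots> = sum c Y"
    using sum_selection[OF Y(1)] by (simp add: cost_def)
  also have "\<dots> \<le> (\<Sum>i\<in>rest. c i * u i)"
    using selection_le_fractional[OF finite_rest Y(1,3,4)] u Y(2) by simp
  finally show ?thesis .
qed

lemma sum_le_recourse_cost:
  assumes Y: "Y \<subseteq> rest" "card Y = open_quota" "\<forall>i\<in>Y. c i \<le> \<alpha>" "\<forall>i\<in>rest - Y. \<alpha> \<le> c i"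
  shows "sum c Y \<le> recourse_cost I x c"
proof -
  have le: "sum c Y \<le> cost I c y" if y: "y \<in> second_stage I x" for y
  proof -
    have y01: "y i = 0 \<or> y i = 1" "x i + y i \<le> 1" if "i \<in> {1..items I}" for i
      using y that by (auto simp: second_stage_def PiE_iff)
    then have off: "y i = 0" if "i \<in> {1..items I}" "i \<notin> rest" for i
      using that x_cases[of i] by (fastforce simp: rest_def)
    have "(\<Sum>i\<in>{1..items I}. x i) + (\<Sum>i\<in>{1..items I}. y i) = quota I"
      using y by (simp add: second_stage_def sum.distrib)
    then have "(\<Sum>i\<in>{1..items I}. y i) = open_quota"
      by (simp add: open_quota_def)
    then have "(\<Sum>i\<in>rest. y i) = open_quota"
      using sum_restrict_rest[of y] off by simp
    then have "(\<Sum>i\<in>rest. real (y i)) = real (card Y)"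
      using Y(2) by (simp flip: of_nat_sum)
    then have "sum c Y \<le> (\<Sum>i\<in>rest. c i * real (y i))"
      using y01 rest_subset by (intro selection_le_fractional[OF finite_rest Y(1,3,4)]) fastforce+
    also have "\<dots> = cost I c y"
      unfolding cost_def using sum_restrict_rest[of "\<lambda>i. c i * real (y i)"] off by simp
    finally show ?thesis .
  qed
  have "second_stage I x \<noteq> {}"
    using selection_in_second_stage[OF Y(1,2)] by blast
  then show ?thesis
    unfolding recourse_cost_def using finite_second_stage le by (intro Min.boundedI) auto
qed

text \<open>Weak duality with multiplier \<open>\<theta> = j / q\<close>. Dividing the amounts by
  \<open>q\<close> gives a fractional selection of the right total. For a fully selected item, the
  share \<open>1 - \<theta>\<close> of the deviation is covered by the upper cost; the share
  \<open>\<theta>\<close> remains, and over all items these shares sum to at most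
  \<open>\<theta>\<close> times the budget.\<close>

lemma recourse_cost_le_pattern_value:
  assumes f: "pattern I q j f" "first_items I f = x" and c: "c \<in> continuous_scenarios I"
  shows "cost I (\<lambda>i. of_rat (first_cost I i)) x + recourse_cost I x c \<le> pattern_value I q j f"
proof -
  from c obtain \<delta> where \<delta>: "c = (\<lambda>i\<in>{1..items I}. lo i + \<delta> i)"
      "\<And>i. i \<in> {1..items I} \<Longrightarrow> 0 \<le> \<delta> i \<and> \<delta> i \<le> hi i - lo i"
      "(\<Sum>i\<in>{1..items I}. \<delta> i) \<le> of_rat (budget I)"
    by (auto simp: continuous_scenarios_def lo_def hi_def deviation_def of_rat_diff)
  have q: "1 \<le> q" "j \<le> q" using f by (auto simp: pattern_def)
  define \<theta> where "\<theta> = real j / real q"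
  have \<theta>: "0 \<le> \<theta>" "\<theta> \<le> 1" using q by (auto simp: \<theta>_def)
  define u where "u i = real (amount q j (f i)) / real q" for i
  have x_eq: "x i = (if f i = First then 1 else 0)" if "i \<in> {1..items I}" for i
    using f(2) that by (auto simp: first_items_def)
  have rest_eq: "i \<in> rest \<longleftrightarrow> f i \<noteq> First" if "i \<in> {1..items I}" for i
    using x_eq[OF that] that by (simp add: rest_def)
  have u01: "0 \<le> u i \<and> u i \<le> 1" for i
    using q by (cases "f i") (auto simp: u_def)
  have "(\<Sum>i\<in>{1..items I}. u i) = real (\<Sum>i\<in>{1..items I}. amount q j (f i)) / real q"
    by (simp add: u_def sum_divide_distrib)
  then have sum_u: "(\<Sum>i\<in>{1..items I}. u i) = real (quota I)"
    using f(1) q by (simp add: pattern_def del: of_nat_sum)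
  have "(\<Sum>i\<in>{1..items I}. u i) = (\<Sum>i\<in>{1..items I}. real (x i) + (if i \<in> rest then u i else 0))"
    using x_eq rest_eq q by (intro sum.cong) (auto simp: u_def)
  also have "\<dots> = real (\<Sum>i\<in>{1..items I}. x i) + sum u ({1..items I} \<inter> rest)"
    by (simp add: sum.distrib sum.inter_restrict)
  also have "{1..items I} \<inter> rest = rest" using rest_subset by blast
  finally have sum_u_rest: "sum u rest = real open_quota"
    using sum_u sum_x_le_quota by (simp add: open_quota_def)
  define pr where "pr i = price q j (of_rat (first_cost I i)) (lo i) (hi i) (f i) / real q" for i
  have "recourse_cost I x c \<le> (\<Sum>i\<in>rest. c i * u i)"
    using recourse_cost_le_fractional sum_u_rest u01 by blast
  also have "\<dots> = (\<Sum>i\<in>{1..items I} \<inter> rest. c i * u i)"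
    using rest_subset by (simp add: Int_absorb1)
  also have "\<dots> = (\<Sum>i\<in>{1..items I}. if i \<in> rest then c i * u i else 0)"
    by (simp add: sum.inter_restrict)
  also have "\<dots> \<le> (\<Sum>i\<in>{1..items I}. pr i + \<theta> * \<delta> i - of_rat (first_cost I i) * real (x i))"
  proof (intro sum_mono)
    fix i assume i: "i \<in> {1..items I}"
    have c_eq: "c i = lo i + \<delta> i" using i \<delta>(1) by simp
    have nonneg: "0 \<le> \<theta> * \<delta> i" using \<theta> \<delta>(2)[OF i] by simp
    show "(if i \<in> rest then c i * u i else 0) \<le> pr i + \<theta> * \<delta> i - of_rat (first_cost I i) * real (x i)"
    proof (cases "f i")
      case Recourse
      have "(1 - \<theta>) * \<delta> i \<le> (1 - \<theta>) * (hi i - lo i)"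
        using \<delta>(2)[OF i] \<theta> by (intro mult_left_mono) auto
      moreover have "pr i = \<theta> * lo i + (1 - \<theta>) * hi i"
        using Recourse q by (simp add: pr_def \<theta>_def field_simps)
      moreover have "x i = 0" "i \<in> rest" "u i = 1"
        using x_eq[OF i] rest_eq[OF i] Recourse q by (auto simp: u_def)
      ultimately show ?thesis using c_eq by (simp add: algebra_simps)
    next
      case Partial
      moreover have "pr i = \<theta> * lo i" "u i = \<theta>"
        using Partial by (simp_all add: pr_def \<theta>_def u_def)
      ultimately show ?thesis
        using x_eq[OF i] rest_eq[OF i] c_eq by (simp add: algebra_simps)
    next
      case First
      then show ?thesis
        using x_eq[OF i] rest_eq[OF i] q nonneg by (simp add: pr_def)
    next
      case Unused
      then show ?thesis
        using x_eq[OF i] nonneg by (simp add: pr_def u_def)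
    qed
  qed
  also have "\<dots> = (\<Sum>i\<in>{1..items I}. pr i) + \<theta> * (\<Sum>i\<in>{1..items I}. \<delta> i)
      - cost I (\<lambda>i. of_rat (first_cost I i)) x"
    by (simp add: sum_subtractf sum.distrib cost_def sum_distrib_left)
  also have "\<dots> \<le> (\<Sum>i\<in>{1..items I}. pr i) + \<theta> * of_rat (budget I)
      - cost I (\<lambda>i. of_rat (first_cost I i)) x"
    using \<delta>(3) \<theta> by (simp add: mult_left_mono)
  also have "(\<Sum>i\<in>{1..items I}. pr i) + \<theta> * of_rat (budget I) = pattern_value I q j f"
    by (simp add: pattern_value_def pr_def \<theta>_def lo_def hi_def add_divide_distrib sum_divide_distrib)
  finally show ?thesis by simp
qed

text \<open>An optimality certificate: the attack \<open>\<delta>\<close> leaves \<open>Y\<close>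
  cheapest, and the pattern with \<open>Partial\<close> on \<open>A\<close> and
  \<open>Recourse\<close> on \<open>B\<close> has the value that \<open>Y\<close> costs. The three
  cases of the strong duality proof only supply the data.\<close>

lemma pattern_from_selection:
  assumes AB: "A \<subseteq> rest" "B \<subseteq> rest" "A \<inter> B = {}" and q: "1 \<le> q" "j \<le> q"
    and amount: "q * open_quota = j * card A + q * card B"
    and \<delta>: "\<And>i. i \<in> {1..items I} \<Longrightarrow> 0 \<le> \<delta> i \<and> \<delta> i \<le> hi i - lo i"
      "(\<Sum>i\<in>{1..items I}. \<delta> i) \<le> of_rat (budget I)"
    and Y: "Y \<subseteq> rest" "card Y = open_quota" "\<forall>i\<in>Y. lo i + \<delta> i \<le> \<alpha>" "\<forall>i\<in>rest - Y. \<alpha> \<le> lo i + \<delta> i"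
    and val: "real q * (\<Sum>i\<in>Y. lo i + \<delta> i) =
      real j * (sum lo A + sum lo B + of_rat (budget I)) + (real q - real j) * sum hi B"
  shows "\<exists>f. pattern I q j f \<and> first_items I f = x \<and> (\<exists>c\<in>continuous_scenarios I.
      pattern_value I q j f \<le> cost I (\<lambda>i. of_rat (first_cost I i)) x + recourse_cost I x c)"
proof -
  define f where "f i = (if x i = 1 then First else if i \<in> A then Partial else
    if i \<in> B then Recourse else Unused)" for i
  \<comment> \<open>Stated over an arbitrary semiring since it is applied to amounts in
    \<open>nat\<close> and to prices in \<open>real\<close>.\<close>
  have split: "(\<Sum>i\<in>{1..items I}. g i (f i)) = (\<Sum>i\<in>{1..items I}. g i First * of_nat (x i))
      + (\<Sum>i\<in>A. g i Partial) + (\<Sum>i\<in>B. g i Recourse)"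
    if "\<And>i. g i Unused = 0" for g :: "nat \<Rightarrow> choice \<Rightarrow> 'c::comm_semiring_1"
  proof -
    have sub: "{1..items I} \<inter> A = A" "{1..items I} \<inter> B = B"
      using AB rest_subset by auto
    have "(\<Sum>i\<in>{1..items I}. g i (f i)) = (\<Sum>i\<in>{1..items I}. g i First * of_nat (x i)
      + (if i \<in> A then g i Partial else 0) + (if i \<in> B then g i Recourse else 0))"
    proof (intro sum.cong refl)
      fix i assume "i \<in> {1..items I}"
      then show "g i (f i) = g i First * of_nat (x i)
      + (if i \<in> A then g i Partial else 0) + (if i \<in> B then g i Recourse else 0)"
        using x_cases[of i] that AB by (auto simp: f_def rest_def)
    qed
    then show ?thesis
      by (simp add: sum.distrib sub flip: sum.inter_restrict)
  qed
  have "(\<Sum>i\<in>{1..items I}. amount q j (f i)) = q * (\<Sum>i\<in>{1..items I}. x i) + q * open_quota"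
    using split[of "\<lambda>i. amount q j"] amount by (simp add: sum_distrib_left)
  also have "\<dots> = q * ((\<Sum>i\<in>{1..items I}. x i) + open_quota)"
    by (simp only: distrib_left)
  also have "\<dots> = quota I * q"
    using sum_x_le_quota by (simp add: open_quota_def)
  finally have pat: "pattern I q j f"
    using q by (simp add: pattern_def)
  have fi: "first_items I f = x"
  proof
    fix i
    show "first_items I f i = x i"
      using x_cases[of i] x by (auto simp: first_items_def f_def first_stage_def PiE_iff extensional_def)
  qed
  define c where "c = (\<lambda>i\<in>{1..items I}. lo i + \<delta> i)"
  have "c \<in> continuous_scenarios I"
    unfolding continuous_scenarios_def c_def using \<delta>
    by (auto simp: lo_def hi_def deviation_def of_rat_diff)
  have c: "c i = lo i + \<delta> i" if "i \<in> rest" for i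
    using that rest_subset by (auto simp: c_def)
  have "sum c Y \<le> recourse_cost I x c"
    using Y c by (intro sum_le_recourse_cost[of Y c \<alpha>]) auto
  moreover have "sum c Y = (\<Sum>i\<in>Y. lo i + \<delta> i)"
    using Y(1) c by (intro sum.cong) auto
  moreover have "real q * pattern_value I q j f = real q * cost I (\<lambda>i. of_rat (first_cost I i)) x
      + real q * (\<Sum>i\<in>Y. lo i + \<delta> i)"
  proof -
    have "real q * pattern_value I q j f = (\<Sum>i\<in>{1..items I}.
        price q j (of_rat (first_cost I i)) (lo i) (hi i) (f i)) + real j * of_rat (budget I)"
      using q by (simp add: pattern_value_def lo_def[symmetric] hi_def[symmetric])
    also have "\<dots> = real q * cost I (\<lambda>i. of_rat (first_cost I i)) x + (real j *
        (sum lo A + sum lo B + of_rat (budget I)) + (real q - real j) * sum hi B)"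
      by (subst split) (simp_all add: cost_def sum.distrib sum_subtractf sum_distrib_left algebra_simps)
    finally show ?thesis using val by simp
  qed
  then have "real q * pattern_value I q j f = real q * (cost I (\<lambda>i. of_rat (first_cost I i)) x
      + (\<Sum>i\<in>Y. lo i + \<delta> i))"
    by (simp add: distrib_left)
  then have "pattern_value I q j f = cost I (\<lambda>i. of_rat (first_cost I i)) x + (\<Sum>i\<in>Y. lo i + \<delta> i)"
    using q by simp
  ultimately show ?thesis
    using pat fi \<open>c \<in> continuous_scenarios I\<close> by (intro exI[of _ f]) force
qed

text \<open>Strong duality by water filling: raise all costs below a level \<open>\<alpha>\<close>
  to \<open>\<alpha>\<close>, or to the upper cost if that is smaller. Only levels between the
  \<open>open_quota\<close>-th smallest lower cost and the \<open>open_quota\<close>-th smallest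
  upper cost matter; the cases compare the budget with the price of these two levels.\<close>

lemma obtain_tight_pattern:
  obtains q j f c where "q \<le> items I" "pattern I q j f" "first_items I f = x"
    "c \<in> continuous_scenarios I"
    "pattern_value I q j f \<le> cost I (\<lambda>i. of_rat (first_cost I i)) x + recourse_cost I x c"
proof -
  let ?ok = "\<lambda>q j. \<exists>f. pattern I q j f \<and> first_items I f = x \<and> (\<exists>c\<in>continuous_scenarios I.
      pattern_value I q j f \<le> cost I (\<lambda>i. of_rat (first_cost I i)) x + recourse_cost I x c)"
  define \<Gamma> where "\<Gamma> = real_of_rat (budget I)"
  have \<Gamma>: "0 \<le> \<Gamma>" using valid by (simp add: valid_r2st_def \<Gamma>_def)
  have n: "1 \<le> items I" using valid by (auto simp: valid_r2st_def)
  \<comment> \<open>\<open>\<delta> \<alpha>\<close> is the attack that fills up to level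
    \<open>\<alpha>\<close>, and \<open>h \<alpha>\<close> is the budget it consumes.\<close>
  define \<delta> where "\<delta> \<alpha> i = (if i \<in> rest then min (hi i - lo i) (max 0 (\<alpha> - lo i)) else 0)" for \<alpha> i
  define h where "h \<alpha> = sum (\<delta> \<alpha>) rest" for \<alpha>
  have \<delta>: "0 \<le> \<delta> \<alpha> i \<and> \<delta> \<alpha> i \<le> hi i - lo i" if "i \<in> {1..items I}" for \<alpha> i
    using lo_hi[OF that] by (auto simp: \<delta>_def)
  have sum_\<delta>: "sum (\<delta> \<alpha>) {1..items I} = h \<alpha>" for \<alpha>
    unfolding h_def by (rule sum_restrict_rest) (simp add: \<delta>_def)
  have h_nonneg: "0 \<le> h \<alpha>" for \<alpha>
    unfolding h_def using \<delta> rest_subset by (intro sum_nonneg) blast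
  have "\<exists>q j. q \<le> items I \<and> ?ok q j"
  proof (cases "open_quota = 0")
    case True
    \<comment> \<open>Nothing remains to be selected, so no attack has any effect and the multiplier
      is \<open>0\<close>.\<close>
    have "?ok 1 0"
      by (rule pattern_from_selection[of "{}" "{}" _ _ "\<lambda>_. 0" "{}" 0])
        (use True lo_hi \<Gamma> rest_subset in \<open>auto simp: \<Gamma>_def\<close>)
    then show ?thesis using n by blast
  next
    case False
    then have m: "1 \<le> open_quota" by simp
    obtain A a where A: "A \<subseteq> rest" "card A = open_quota" "a \<in> A" "\<forall>i\<in>A. lo i \<le> lo a"
        "\<forall>i\<in>rest - A. lo a \<le> lo i"
      using obtain_smallest_subset[OF finite_rest m open_quota_le_card_rest] by blast
    obtain B b where B: "B \<subseteq> rest" "card B = open_quota" "b \<in> B" "\<forall>i\<in>B. hi i \<le> hi b"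
        "\<forall>i\<in>rest - B. hi b \<le> hi i"
      using obtain_smallest_subset[OF finite_rest m open_quota_le_card_rest] by blast
    have le: "0 \<le> lo i" "lo i \<le> hi i" if "i \<in> rest" for i
      using lo_hi[of i] that rest_subset by auto
    consider "\<Gamma> \<le> h (lo a)" | "h (hi b) \<le> \<Gamma>" | "h (lo a) < \<Gamma>" "\<Gamma> < h (hi b)" by linarith
    then show ?thesis
    proof cases
      case 1
      \<comment> \<open>The budget cannot lift the cheapest selection \<open>A\<close> to the level
        \<open>lo a\<close>. A scaled-down attack spends it entirely on \<open>A\<close>, which
        stays cheapest; each budget unit costs one unit, so the multiplier is
        \<open>1\<close>.\<close>
      obtain \<theta> where \<theta>: "0 \<le> \<theta>" "\<theta> \<le> 1" "\<theta> * h (lo a) = \<Gamma>"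
      proof (cases "h (lo a) = 0")
        case True
        then show ?thesis using that[of 0] 1 \<Gamma> by simp
      next
        case False
        then show ?thesis using that[of "\<Gamma> / h (lo a)"] 1 \<Gamma> h_nonneg[of "lo a"] by simp
      qed
      define \<delta>' where "\<delta>' i = \<theta> * \<delta> (lo a) i" for i
      have \<delta>': "0 \<le> \<delta>' i \<and> \<delta>' i \<le> \<delta> (lo a) i" if "i \<in> {1..items I}" for i
        using \<delta>[OF that, of "lo a"] \<theta> by (simp add: \<delta>'_def mult_left_le_one_le)
      have zero: "\<delta>' i = 0" if "i \<in> rest - A" for i
        using A(5) that le[of i] by (auto simp: \<delta>'_def \<delta>_def)
      have sum_\<delta>': "sum \<delta>' {1..items I} = \<Gamma>"
        unfolding \<delta>'_def using sum_\<delta> \<theta>(3) by (simp flip: sum_distrib_left)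
      also have "sum \<delta>' {1..items I} = sum \<delta>' rest"
        by (rule sum_restrict_rest) (simp add: \<delta>'_def \<delta>_def)
      also have "\<dots> = sum \<delta>' A"
        using A(1) zero finite_rest by (intro sum.mono_neutral_right) auto
      finally have sum_A: "sum \<delta>' A = \<Gamma>" .
      have "?ok 1 1"
      proof (rule pattern_from_selection[of A "{}" _ _ \<delta>' A "lo a"])
        show "\<forall>i\<in>A. lo i + \<delta>' i \<le> lo a"
        proof
          fix i assume i: "i \<in> A"
          then have "\<delta>' i \<le> \<delta> (lo a) i" using \<delta>' A(1) rest_subset by blast
          then show "lo i + \<delta>' i \<le> lo a"
            using A(4) i A(1) by (auto simp: \<delta>_def subset_iff)
        qed
        show "\<forall>i\<in>rest - A. lo a \<le> lo i + \<delta>' i"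
          using zero A(5) by auto
        show "0 \<le> \<delta>' i \<and> \<delta>' i \<le> hi i - lo i" if "i \<in> {1..items I}" for i
          using \<delta>[OF that, of "lo a"] \<delta>'[OF that] by linarith
      qed (use A sum_A sum_\<delta>' \<Gamma>_def in \<open>auto simp: sum.distrib\<close>)
      then show ?thesis using n by blast
    next
      case 2
      \<comment> \<open>The budget suffices for the level \<open>hi b\<close>, where
        \<open>B\<close> is cheapest at its upper costs. More budget would not help the adversary,
        so the multiplier is \<open>0\<close>.\<close>
      have hi_B: "lo i + \<delta> (hi b) i = hi i" if "i \<in> B" for i
        using that B(1,4) le[of i] by (auto simp: \<delta>_def)
      have "?ok 1 0"
      proof (rule pattern_from_selection[of "{}" B _ _ "\<delta> (hi b)" B "hi b"])
        show "\<forall>i\<in>B. lo i + \<delta> (hi b) i \<le> hi b"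
          using hi_B B(4) by simp
        show "\<forall>i\<in>rest - B. hi b \<le> lo i + \<delta> (hi b) i"
          using B(5) by (simp add: \<delta>_def min_def max_def)
        show "real 1 * (\<Sum>i\<in>B. lo i + \<delta> (hi b) i) =
            real 0 * (sum lo {} + sum lo B + of_rat (budget I)) + (real 1 - real 0) * sum hi B"
          using hi_B by simp
      qed (use B \<delta> sum_\<delta> 2 \<Gamma>_def in auto)
      then show ?thesis using n by blast
    next
      case 3
      have "h (lo a) \<le> \<Gamma>" "\<Gamma> \<le> h (hi b)" using 3 by auto
      have ab: "lo a \<le> hi b"
      proof (rule ccontr)
        assume "\<not> lo a \<le> hi b"
        then have "h (hi b) \<le> h (lo a)"
          unfolding h_def \<delta>_def by (intro sum_mono) auto
        then show False using 3 by linarith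
      qed
      have "h = (\<lambda>\<alpha>. \<Sum>i\<in>rest. min (hi i - lo i) (max 0 (\<alpha> - lo i)))"
        by (rule ext) (simp add: h_def \<delta>_def)
      then have "continuous_on {lo a..hi b} h"
        by (simp only:) (intro continuous_intros)
      then obtain \<alpha> where \<alpha>: "lo a \<le> \<alpha>" "\<alpha> \<le> hi b" "h \<alpha> = \<Gamma>"
        using IVT'[of h "lo a" \<Gamma> "hi b"] 3 ab by auto
      \<comment> \<open>\<open>h\<close> differs from the budget at both ends. Strictness on the
        right keeps \<open>b\<close> out of \<open>E\<close>, so \<open>E\<close> is too small to
        fill all places; strictness on the left puts \<open>A\<close> inside
        \<open>E \<union> F\<close>, so together they suffice.\<close>
      with 3 have \<alpha>_strict: "lo a < \<alpha>" "\<alpha> < hi b" by (auto simp: less_le)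
      define E where "E = {i \<in> rest. hi i \<le> \<alpha>}"
      define F where "F = {i \<in> rest. lo i < \<alpha> \<and> \<alpha> < hi i}"
      have fin: "finite E" "finite F" "E \<inter> F = {}" "E \<subseteq> rest" "F \<subseteq> rest"
        using finite_rest by (auto simp: E_def F_def)
      have "E \<subset> B"
      proof -
        have "E \<subseteq> B"
        proof
          fix i assume "i \<in> E"
          then show "i \<in> B" using bspec[OF B(5), of i] \<alpha>_strict by (auto simp: E_def)
        qed
        moreover have "b \<notin> E" using \<alpha>_strict by (simp add: E_def)
        ultimately show ?thesis using B(3) by blast
      qed
      then have l: "card E < open_quota"
        using psubset_card_mono[OF finite_subset[OF B(1) finite_rest]] B(2) by auto
      have "A \<subseteq> E \<union> F"
      proof
        fix i assume i: "i \<in> A"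
        then have "lo i < \<alpha>" "i \<in> rest" using A(1,4) \<alpha>_strict by auto
        then show "i \<in> E \<union> F" by (auto simp: E_def F_def)
      qed
      then have k: "open_quota \<le> card E + card F"
        using A(2) card_mono[of "E \<union> F" A] fin by (simp add: card_Un_disjoint)
      \<comment> \<open>All of \<open>E\<close> is selected in full, and the remaining places are
        spread evenly over \<open>F\<close>. Each item of \<open>F\<close> thus gets the fraction
        \<open>j / q\<close>, which is the multiplier.\<close>
      define j where "j = open_quota - card E"
      define q where "q = card F"
      have j: "1 \<le> j" "j \<le> q" using l k by (auto simp: j_def q_def)
      \<comment> \<open>Under the attack all items of \<open>F\<close> cost exactly
        \<open>\<alpha>\<close>, so any \<open>j\<close> of them complete an optimal
        selection.\<close>
      obtain Z where Z: "Z \<subseteq> F" "card Z = j"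
        using j q_def obtain_subset_with_card_n[of j F] by auto
      have fin_Z: "finite Z" using Z(1) fin(2) finite_subset by blast
      have c_E: "\<delta> \<alpha> i = hi i - lo i" if "i \<in> E" for i
        using that le[of i] by (auto simp: E_def \<delta>_def)
      have c_F: "\<delta> \<alpha> i = \<alpha> - lo i" if "i \<in> F" for i
        using that by (auto simp: F_def \<delta>_def)
      have c_0: "\<delta> \<alpha> i = 0 \<and> \<alpha> \<le> lo i" if "i \<in> rest - (E \<union> F)" for i
        using that le[of i] by (auto simp: E_def F_def \<delta>_def)
      have "h \<alpha> = sum (\<delta> \<alpha>) (E \<union> F)"
        unfolding h_def using c_0 fin finite_rest by (intro sum.mono_neutral_right) auto
      also have "\<dots> = sum (\<delta> \<alpha>) E + sum (\<delta> \<alpha>) F"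
        using fin by (intro sum.union_disjoint)
      also have "\<dots> = (sum hi E - sum lo E) + (real q * \<alpha> - sum lo F)"
        using c_E c_F by (simp add: sum_subtractf q_def)
      finally have \<Gamma>_eq: "\<Gamma> = (sum hi E - sum lo E) + (real q * \<alpha> - sum lo F)"
        using \<alpha>(3) by simp
      have EZ: "E \<inter> Z = {}" using Z(1) fin(3) by blast
      have sum_Y: "(\<Sum>i\<in>E \<union> Z. lo i + \<delta> \<alpha> i) = sum hi E + real j * \<alpha>"
      proof -
        have "(\<Sum>i\<in>Z. lo i + \<delta> \<alpha> i) = (\<Sum>i\<in>Z. \<alpha>)"
          using c_F Z(1) by (intro sum.cong) auto
        then show ?thesis
          using fin fin_Z EZ c_E Z(2) by (simp add: sum.union_disjoint)
      qed
      have "?ok q j"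
      proof (rule pattern_from_selection[of F E _ _ "\<delta> \<alpha>" "E \<union> Z" \<alpha>])
        show "q * open_quota = j * card F + q * card E"
          using l by (simp add: j_def q_def[symmetric] diff_mult_distrib algebra_simps)
        show "card (E \<union> Z) = open_quota"
          using fin fin_Z EZ Z(2) l by (simp add: card_Un_disjoint j_def)
        show "\<forall>i\<in>E \<union> Z. lo i + \<delta> \<alpha> i \<le> \<alpha>"
          using c_E c_F Z(1) by (auto simp: E_def)
        show "\<forall>i\<in>rest - (E \<union> Z). \<alpha> \<le> lo i + \<delta> \<alpha> i"
        proof
          fix i assume "i \<in> rest - (E \<union> Z)"
          then show "\<alpha> \<le> lo i + \<delta> \<alpha> i" using c_F[of i] c_0[of i] by (cases "i \<in> F") auto
        qed
        show "real q * (\<Sum>i\<in>E \<union> Z. lo i + \<delta> \<alpha> i) =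
            real j * (sum lo F + sum lo E + of_rat (budget I)) + (real q - real j) * sum hi E"
          unfolding sum_Y \<Gamma>_def[symmetric] \<Gamma>_eq by (simp add: algebra_simps)
      qed (use fin Z j \<delta> sum_\<delta> \<alpha>(3) \<Gamma>_def in auto)
      moreover have "q \<le> items I"
        using card_mono[of "{1..items I}" F] fin(5) rest_subset by (simp add: q_def)
      ultimately show ?thesis by blast
    qed
  qed
  then show thesis using that by blast
qed

text \<open>Weak duality at the tight pattern bounds every scenario by the tight one. The maximum
  behind \<open>GREATEST\<close> is therefore attained and its value is the tight pattern's.\<close>

lemma robust_cost_cases:
  obtains q j f where "q \<le> items I" "pattern I q j f" "first_items I f = x"
    "robust_cost I x = pattern_value I q j f"
    "\<And>q j f. pattern I q j f \<Longrightarrow> first_items I f = x \<Longrightarrow> robust_cost I x \<le> pattern_value I q j f"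
proof -
  obtain q j f c where w: "q \<le> items I" "pattern I q j f" "first_items I f = x"
    "c \<in> continuous_scenarios I"
    "pattern_value I q j f \<le> cost I (\<lambda>i. of_rat (first_cost I i)) x + recourse_cost I x c"
    by (rule obtain_tight_pattern)
  have "(GREATEST v. v \<in> recourse_cost I x ` continuous_scenarios I) = recourse_cost I x c"
    using w recourse_cost_le_pattern_value[OF w(2,3)]
    by (intro Greatest_equality) (auto, smt (verit))
  then have r: "robust_cost I x = cost I (\<lambda>i. of_rat (first_cost I i)) x + recourse_cost I x c"
    by (simp add: robust_cost_def)
  then have "robust_cost I x = pattern_value I q j f"
    using w recourse_cost_le_pattern_value[OF w(2,3,4)] by simp
  then show thesis
    using that w r recourse_cost_le_pattern_value[OF _ _ w(4)] by metis
qed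

end

text \<open>There is no bound on \<open>q\<close> here, so enumerating pairs with
  \<open>q > n\<close> cannot produce a value below the optimum.\<close>

lemma robust_cost_le_pattern_value:
  assumes "valid_r2st I" "pattern I q j f"
  shows "robust_cost I (first_items I f) \<le> pattern_value I q j f"
proof -
  interpret first_stage_solution I "first_items I f"
    by unfold_locales (use assms first_items_in_first_stage in auto)
  show ?thesis using robust_cost_cases assms(2) by metis
qed

lemma robust_cost_attained:
  assumes "valid_r2st I" "x \<in> first_stage I"
  obtains q j f where "q \<le> items I" "pattern I q j f" "robust_cost I x = pattern_value I q j f"
proof -
  interpret first_stage_solution I x
    by unfold_locales (use assms in auto)
  show ?thesis using robust_cost_cases that by metis
qed

section \<open>The knapsack recursion\<close>

definition improve :: "nat \<Rightarrow> int \<Rightarrow> (nat \<Rightarrow> int) \<Rightarrow> nat \<Rightarrow> int \<Rightarrow> int" where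
  "improve d e T t v = (if d \<le> t then max v (T (t - d) + e) else v)"

text \<open>The initial value \<open>0\<close> at every capacity makes this a recursion for total
  length at most \<open>t\<close>, and it is also the content of fresh memory.
  \<open>Partial\<close> comes innermost because its length \<open>j\<close> may be
  \<open>0\<close>: in the in-place computation it then reads the very cell being updated, which
  must still hold the old row.\<close>

primrec knap :: "nat \<Rightarrow> nat \<Rightarrow> (nat \<Rightarrow> choice \<Rightarrow> int) \<Rightarrow> nat \<Rightarrow> nat \<Rightarrow> int" where
  "knap q j g 0 t = 0"
| "knap q j g (Suc k) t =
     improve q (g (Suc k) First) (knap q j g k) t
       (improve q (g (Suc k) Recourse) (knap q j g k) t
         (improve j (g (Suc k) Partial) (knap q j g k) t (knap q j g k t)))"

lemma sum_gain_le_knap: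
  assumes "\<And>i. g i Unused = 0" "(\<Sum>i\<in>{1..k}. amount q j (f i)) \<le> t"
  shows "(\<Sum>i\<in>{1..k}. g i (f i)) \<le> knap q j g k t"
  using assms(2)
proof (induction k arbitrary: t)
  case (Suc k)
  have am: "(\<Sum>i\<in>{1..k}. amount q j (f i)) \<le> t - amount q j (f (Suc k))" "amount q j (f (Suc k)) \<le> t"
    using Suc.prems by simp_all
  have "(\<Sum>i\<in>{1..k}. g i (f i)) \<le> knap q j g k (t - amount q j (f (Suc k)))"
    by (rule Suc.IH[OF am(1)])
  then show ?case
    using am(2) assms(1) by (cases "f (Suc k)") (auto simp: improve_def)
qed simp

lemma knap_attained:
  assumes "\<And>i. g i Unused = 0"
  shows "\<exists>f. (\<Sum>i\<in>{1..k}. amount q j (f i)) \<le> t \<and> knap q j g k t = (\<Sum>i\<in>{1..k}. g i (f i))"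
proof (induction k arbitrary: t)
  case (Suc k)
  have step: "\<exists>f. (\<Sum>i\<in>{1..Suc k}. amount q j (f i)) \<le> t \<and>
      knap q j g k (t - amount q j c) + g (Suc k) c = (\<Sum>i\<in>{1..Suc k}. g i (f i))"
    if "amount q j c \<le> t" for c
  proof -
    obtain f where f: "(\<Sum>i\<in>{1..k}. amount q j (f i)) \<le> t - amount q j c"
        "knap q j g k (t - amount q j c) = (\<Sum>i\<in>{1..k}. g i (f i))"
      using Suc.IH by blast
    have "(\<Sum>i\<in>{1..k}. amount q j ((f(Suc k := c)) i)) = (\<Sum>i\<in>{1..k}. amount q j (f i))"
      "(\<Sum>i\<in>{1..k}. g i ((f(Suc k := c)) i)) = (\<Sum>i\<in>{1..k}. g i (f i))"
      by (intro sum.cong; simp)+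
    then show ?thesis
      using f that by (intro exI[of _ "f(Suc k := c)"]) simp
  qed
  have "\<exists>c. amount q j c \<le> t \<and> knap q j g (Suc k) t = knap q j g k (t - amount q j c) + g (Suc k) c"
  proof -
    define a0 where "a0 = knap q j g k t"
    define a1 where "a1 = improve j (g (Suc k) Partial) (knap q j g k) t a0"
    define a2 where "a2 = improve q (g (Suc k) Recourse) (knap q j g k) t a1"
    have "\<exists>c. amount q j c \<le> t \<and> a0 = knap q j g k (t - amount q j c) + g (Suc k) c"
      by (rule exI[of _ Unused]) (simp add: a0_def assms)
    then have "\<exists>c. amount q j c \<le> t \<and> a1 = knap q j g k (t - amount q j c) + g (Suc k) c"
      unfolding a1_def improve_def max_def
      by (auto simp: split: if_splits) (metis amount.simps(2))
    then have "\<exists>c. amount q j c \<le> t \<and> a2 = knap q j g k (t - amount q j c) + g (Suc k) c"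
      unfolding a2_def improve_def max_def
      by (auto simp: split: if_splits) (metis amount.simps(3))
    then show ?thesis
      unfolding knap.simps a0_def[symmetric] a1_def[symmetric] a2_def[symmetric]
      unfolding improve_def max_def
      by (auto simp: split: if_splits) (metis amount.simps(4))
  qed
  then show ?case using step by metis
qed simp

section \<open>Binary representation of item sets\<close>

lemma sum_bits_less:
  fixes b :: "nat \<Rightarrow> int"
  assumes "\<And>i. i < n \<Longrightarrow> b i = 0 \<or> b i = 1"
  shows "0 \<le> (\<Sum>i<n. b i * 2 ^ i) \<and> (\<Sum>i<n. b i * 2 ^ i) < 2 ^ n"
  using assms
proof (induction n)
  case (Suc n)
  then have "0 \<le> (\<Sum>i<n. b i * 2 ^ i) \<and> (\<Sum>i<n. b i * 2 ^ i) < 2 ^ n" by simp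
  moreover have "b n = 0 \<or> b n = 1" using Suc.prems by simp
  ultimately show ?case by auto
qed simp

lemma sum_bits_div_mod:
  fixes b :: "nat \<Rightarrow> int"
  assumes "\<And>i. i < n \<Longrightarrow> b i = 0 \<or> b i = 1" "k < n"
  shows "(\<Sum>i<n. b i * 2 ^ i) div 2 ^ k mod 2 = b k"
  using assms
proof (induction n)
  case (Suc n)
  let ?s = "\<Sum>i<n. b i * 2 ^ i"
  have s: "0 \<le> ?s" "?s < 2 ^ n" using sum_bits_less[of n b] Suc.prems by auto
  show ?case
  proof (cases "k = n")
    case True
    have "(?s + b n * 2 ^ n) div 2 ^ n = b n"
      using s by simp
    then show ?thesis using True Suc.prems(1)[of n] by auto
  next
    case False
    then have k: "k < n" using Suc.prems by simp
    then have "(2::int) ^ n = 2 ^ k * (2 * 2 ^ (n - k - 1))"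
      by (simp flip: power_add power_Suc)
    then have "(?s + b n * 2 ^ n) div 2 ^ k = (?s + (b n * (2 * 2 ^ (n - k - 1))) * 2 ^ k) div 2 ^ k"
      by (simp add: algebra_simps)
    also have "\<dots> = ?s div 2 ^ k + 2 * (b n * 2 ^ (n - k - 1))"
      by (subst div_mult_self1) simp_all
    finally have "(?s + b n * 2 ^ n) div 2 ^ k mod 2 = ?s div 2 ^ k mod 2"
      by simp
    then show ?thesis using Suc k by simp
  qed
qed simp

section \<open>Integer scores\<close>

text \<open>\<open>V\<close> lists the scaled numbers in the order of the input word: the budget,
  then three costs per item.\<close>

locale scaled_instance =
  fixes I :: r2st_instance and D :: int and V :: "nat \<Rightarrow> int"
  assumes valid: "valid_r2st I" and D_pos: "0 < D"
    and V_budget: "of_int (V 0) = of_int D * budget I"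
    and V_first: "\<And>i. i \<in> {1..items I} \<Longrightarrow> of_int (V (3 * i - 2)) = of_int D * first_cost I i"
    and V_lower: "\<And>i. i \<in> {1..items I} \<Longrightarrow> of_int (V (3 * i - 1)) = of_int D * lower_cost I i"
    and V_upper: "\<And>i. i \<in> {1..items I} \<Longrightarrow> of_int (V (3 * i)) = of_int D * upper_cost I i"
begin

abbreviation "n \<equiv> items I"
abbreviation "p \<equiv> quota I"

text \<open>For an integer \<open>z\<close>, \<open>\<bar>z\<bar> \<le> z * z\<close>, so the sum of
  squares dominates the sum of absolute values and is computed without testing signs.\<close>

definition S :: int where "S = (\<Sum>m<3 * n + 1. V m * V m)"

text \<open>The reward for every unit of length, which makes optimal solutions use the whole capacity.\<close>
definition K :: int where "K = 4 * int n * S + 1"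

text \<open>A solution is scored by \<open>P * objective + mask\<close>, where the binary digits of \<open>mask < P\<close> record the
  items of the first stage.\<close>
definition P :: int where "P = 2 ^ (3 * n + 1)"

definition gain :: "nat \<Rightarrow> nat \<Rightarrow> nat \<Rightarrow> choice \<Rightarrow> int" where
  "gain q j i c = P * (K * int (amount q j c)
     - price q j (V (3 * i - 2)) (V (3 * i - 1)) (V (3 * i)) c) + (if c = First then 2 ^ (i - 1) else 0)"

definition scaled_price :: "nat \<Rightarrow> nat \<Rightarrow> (nat \<Rightarrow> choice) \<Rightarrow> int" where
  "scaled_price q j f = (\<Sum>i\<in>{1..n}. price q j (V (3 * i - 2)) (V (3 * i - 1)) (V (3 * i)) (f i))
     + int j * V 0"

definition mask :: "(nat \<Rightarrow> choice) \<Rightarrow> int" where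
  "mask f = (\<Sum>i<n. int (first_items I f (Suc i)) * 2 ^ i)"

text \<open>Every \<open>u\<close> with \<open>0 < u < (n + 1)\<^sup>2\<close> encodes an admissible pair \<open>(q, j)\<close>. Some of them have \<open>q > n\<close>,
  which does no harm and saves a case distinction.\<close>
definition qq :: "nat \<Rightarrow> nat" where "qq u = u mod (n + 1) + u div (n + 1)"
definition jj :: "nat \<Rightarrow> nat" where "jj u = u mod (n + 1)"

text \<open>The budget term depends on \<open>j\<close> only and is therefore subtracted after the
  knapsack maximisation.\<close>

definition score :: "nat \<Rightarrow> int" where
  "score u = knap (qq u) (jj u) (gain (qq u) (jj u)) n (p * qq u) - P * int (jj u) * V 0"

lemma n_pos: "1 \<le> n" and p_pos: "1 \<le> p" and p_le_n: "p \<le> n"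
  using valid by (auto simp: valid_r2st_def)

lemma S_nonneg: "0 \<le> S"
  by (auto simp: S_def intro!: sum_nonneg)

lemma P_pos: "0 < P"
  by (simp add: P_def)

lemma gain_Unused: "gain q j i Unused = 0"
  by (simp add: gain_def)

lemma first_items_Suc: "i < n \<Longrightarrow> first_items I f (Suc i) = (if f (Suc i) = First then 1 else 0)"
  by (simp add: first_items_def)

lemma mask_bounds: "0 \<le> mask f" "mask f < P"
proof -
  have "0 \<le> mask f \<and> mask f < 2 ^ n"
    unfolding mask_def by (rule sum_bits_less) (simp add: first_items_Suc)
  moreover have "(2::int) ^ n \<le> P"
    unfolding P_def by (rule power_increasing) auto
  ultimately show "0 \<le> mask f" "mask f < P" by auto
qed

lemma mask_bit: "i < n \<Longrightarrow> mask f div 2 ^ i mod 2 = int (first_items I f (Suc i))"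
  unfolding mask_def by (rule sum_bits_div_mod) (simp_all add: first_items_Suc)

lemma sum_gain:
  "(\<Sum>i\<in>{1..n}. gain q j i (f i)) - P * int j * V 0 =
     P * (K * int (\<Sum>i\<in>{1..n}. amount q j (f i)) - scaled_price q j f) + mask f"
proof -
  have "(\<Sum>i\<in>{1..n}. if f i = First then 2 ^ (i - 1) else 0) =
      (\<Sum>i\<in>{1..n}. int (first_items I f i) * 2 ^ (i - 1))"
    by (intro sum.cong) (auto simp: first_items_def)
  also have "\<dots> = mask f"
    unfolding mask_def using sum.atLeast1_atMost_eq[of "\<lambda>i. int (first_items I f i) * 2 ^ (i - 1)" n]
    by (simp add: One_nat_def)
  finally show ?thesis
    unfolding gain_def scaled_price_def sum.distrib
    by (simp add: sum_subtractf algebra_simps flip: sum_distrib_left)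
qed

lemma S_eq: "S = V 0 * V 0 + (\<Sum>i\<in>{1..n}. V (3 * i - 2) * V (3 * i - 2)
    + V (3 * i - 1) * V (3 * i - 1) + V (3 * i) * V (3 * i))"
proof -
  have "(\<Sum>m<3 * k + 1. V m * V m) = V 0 * V 0 + (\<Sum>i\<in>{1..k}. V (3 * i - 2) * V (3 * i - 2)
    + V (3 * i - 1) * V (3 * i - 1) + V (3 * i) * V (3 * i))" for k
  proof (induction k)
    case (Suc k)
    have "{..<3 * Suc k + 1} =
        insert (3 * Suc k) (insert (3 * Suc k - 1) (insert (3 * Suc k - 2) {..<3 * k + 1}))"
      by auto
    then have "(\<Sum>m<3 * Suc k + 1. V m * V m) = V (3 * Suc k) * V (3 * Suc k)
        + (V (3 * Suc k - 1) * V (3 * Suc k - 1) + (V (3 * Suc k - 2) * V (3 * Suc k - 2)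
        + (\<Sum>m<3 * k + 1. V m * V m)))"
      by (simp only:) (subst sum.insert; simp)+
    moreover have "{1..Suc k} = insert (Suc k) {1..k}" by auto
    ultimately show ?case using Suc by simp
  qed (simp add: One_nat_def)
  then show ?thesis by (simp only: S_def)
qed

lemma abs_price_le:
  fixes C l h :: int
  assumes "j \<le> q"
  shows "\<bar>price q j C l h c\<bar> \<le> int q * (C * C + l * l + h * h)"
proof -
  have sq: "\<bar>z\<bar> \<le> z * z" for z :: int
    by (metis abs_ge_zero abs_mult_self_eq mult.right_neutral mult_left_mono zero_less_abs_iff
        abs_zero int_one_le_iff_zero_less mult_zero_left order_refl)
  have nn: "0 \<le> C * C" "0 \<le> l * l" "0 \<le> h * h" by simp_all
  have mono: "int a * \<bar>z\<bar> \<le> int q * (z * z)" if "a \<le> q" for a z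
    using that sq[of z] by (intro mult_mono) auto
  show ?thesis
  proof (cases c)
    case Partial
    have "\<bar>price q j C l h c\<bar> \<le> int q * (l * l)" using Partial mono[OF assms, of l] by (simp add: abs_mult)
    also have "\<dots> \<le> int q * (C * C + l * l + h * h)" using nn by (intro mult_left_mono) auto
    finally show ?thesis .
  next
    case Recourse
    have "\<bar>price q j C l h c\<bar> \<le> int j * \<bar>l\<bar> + int (q - j) * \<bar>h\<bar>"
      using Recourse assms abs_triangle_ineq[of "int j * l" "int (q - j) * h"]
      by (simp add: abs_mult of_nat_diff)
    also have "\<dots> \<le> int q * (l * l) + int q * (h * h)"
      using assms by (intro add_mono mono) auto
    also have "\<dots> \<le> int q * (C * C + l * l + h * h)" using nn by (simp add: distrib_left)
    finally show ?thesis .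
  next
    case First
    have "\<bar>price q j C l h c\<bar> \<le> int q * (C * C)" using First mono[of q C] by (simp add: abs_mult)
    also have "\<dots> \<le> int q * (C * C + l * l + h * h)" using nn by (intro mult_left_mono) auto
    finally show ?thesis .
  qed (use nn in auto)
qed

lemma abs_scaled_price_le:
  assumes "j \<le> q"
  shows "\<bar>scaled_price q j f\<bar> \<le> int q * S"
proof -
  have "\<bar>int j * V 0\<bar> \<le> int q * (V 0 * V 0)"
    using abs_price_le[OF assms, of 0 "V 0" 0 Partial] by simp
  moreover have "\<bar>\<Sum>i\<in>{1..n}. price q j (V (3 * i - 2)) (V (3 * i - 1)) (V (3 * i)) (f i)\<bar>
      \<le> (\<Sum>i\<in>{1..n}. int q * (V (3 * i - 2) * V (3 * i - 2) + V (3 * i - 1) * V (3 * i - 1)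
          + V (3 * i) * V (3 * i)))"
    by (rule order_trans[OF sum_abs]) (intro sum_mono abs_price_le[OF assms])
  ultimately show ?thesis
    unfolding scaled_price_def S_eq distrib_left sum_distrib_left sum.distrib by linarith
qed

lemma scaled_price_pattern_value:
  assumes "1 \<le> q"
  shows "real_of_int (scaled_price q j f) = real q * real_of_int D * pattern_value I q j f"
proof -
  have real: "real_of_int z = real_of_rat (of_int z)" for z by simp
  have V: "real_of_int (V 0) = of_int D * of_rat (budget I)"
    "\<And>i. i \<in> {1..n} \<Longrightarrow> real_of_int (V (3 * i - 2)) = of_int D * of_rat (first_cost I i)"
    "\<And>i. i \<in> {1..n} \<Longrightarrow> real_of_int (V (3 * i - 1)) = of_int D * of_rat (lower_cost I i)"
    "\<And>i. i \<in> {1..n} \<Longrightarrow> real_of_int (V (3 * i)) = of_int D * of_rat (upper_cost I i)"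
    unfolding real V_budget by (simp_all add: V_first V_lower V_upper of_rat_mult)
  have "real_of_int (price q j (V (3 * i - 2)) (V (3 * i - 1)) (V (3 * i)) c) = of_int D *
      price q j (of_rat (first_cost I i)) (of_rat (lower_cost I i)) (of_rat (upper_cost I i)) c"
    if "i \<in> {1..n}" for i c
    using V(2-4)[OF that] by (cases c) (simp_all add: algebra_simps)
  then have "real_of_int (scaled_price q j f) = of_int D * ((\<Sum>i\<in>{1..n}. price q j
      (of_rat (first_cost I i)) (of_rat (lower_cost I i)) (of_rat (upper_cost I i)) (f i))
      + real j * of_rat (budget I))"
    by (simp add: scaled_price_def V(1) distrib_left sum_distrib_left)
  then show ?thesis
    using assms by (simp add: pattern_value_def)
qed

lemma qq_jj:
  assumes "u \<in> {1..<(n + 1) * (n + 1)}"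
  shows "1 \<le> qq u" "jj u \<le> qq u" "qq u \<le> 2 * n"
proof -
  have "u \<noteq> 0" using assms by auto
  then have "qq u \<noteq> 0"
    unfolding qq_def by (metis add_is_0 div_mult_mod_eq mult_zero_left add.right_neutral)
  then show "1 \<le> qq u" by linarith
  show "jj u \<le> qq u" by (simp add: qq_def jj_def)
  have "u mod (n + 1) \<le> n" by (metis Suc_eq_plus1 less_Suc_eq_le mod_less_divisor zero_less_Suc)
  moreover have "u div (n + 1) < n + 1"
    using assms by (intro less_mult_imp_div_less) auto
  ultimately show "qq u \<le> 2 * n" unfolding qq_def by linarith
qed

lemma obtain_index:
  assumes "1 \<le> q" "q \<le> n" "j \<le> q"
  obtains u where "u \<in> {1..<(n + 1) * (n + 1)}" "qq u = q" "jj u = j"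
proof
  \<comment> \<open>The base-\<open>(n + 1)\<close> digits of the index are \<open>q - j\<close> and
    \<open>j\<close>.\<close>
  let ?u = "(q - j) * (n + 1) + j"
  have "j < n + 1" using assms by simp
  then have "?u mod (n + 1) = j" "?u div (n + 1) = q - j"
    by (simp_all add: div_mult_self3)
  then show "qq ?u = q" "jj ?u = j" using assms by (simp_all add: qq_def jj_def)
  have "?u \<le> (q - j) * (n + 1) + j * (n + 1)" by simp
  also have "\<dots> = q * (n + 1)" using assms by (simp flip: add_mult_distrib)
  also have "\<dots> < (n + 1) * (n + 1)" using assms by simp
  finally show "?u \<in> {1..<(n + 1) * (n + 1)}" using assms mult_le_mono[of 1 q 1 "n + 1"] by (cases "j = 0") auto
qed

text \<open>Each item owns one binary digit of the mask, so masks add without carries and stay below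
  \<open>P\<close>. Maximising the score therefore maximises the quotient by \<open>P\<close> first,
  and the remainder is the mask of one maximiser. The reward \<open>K\<close> forces that maximiser
  to be a pattern.\<close>

lemma score_attained:
  assumes u: "u \<in> {1..<(n + 1) * (n + 1)}"
  obtains f where "pattern I (qq u) (jj u) f"
    "score u div P = K * int p * int (qq u) - scaled_price (qq u) (jj u) f"
    "score u mod P = mask f"
    "\<And>f'. pattern I (qq u) (jj u) f' \<Longrightarrow> scaled_price (qq u) (jj u) f \<le> scaled_price (qq u) (jj u) f'"
proof -
  define q where "q = qq u"
  define j where "j = jj u"
  have q: "1 \<le> q" "j \<le> q" "q \<le> 2 * n" using qq_jj[OF u] by (auto simp: q_def j_def)
  obtain f where f: "(\<Sum>i\<in>{1..n}. amount q j (f i)) \<le> p * q"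
      "knap q j (gain q j) n (p * q) = (\<Sum>i\<in>{1..n}. gain q j i (f i))"
    using knap_attained[of "gain q j"] gain_Unused by blast
  let ?a = "\<Sum>i\<in>{1..n}. amount q j (f i)"
  have score: "score u = P * (K * int ?a - scaled_price q j f) + mask f"
    using sum_gain[of q j f] f(2) by (simp add: score_def flip: q_def j_def)
  have le: "P * (K * int (p * q) - scaled_price q j f') + mask f' \<le> score u"
    if "(\<Sum>i\<in>{1..n}. amount q j (f' i)) = p * q" for f'
    using sum_gain_le_knap[of "gain q j" q j f' n "p * q"] sum_gain[of q j f'] that gain_Unused
    by (simp add: score_def flip: q_def j_def)
  \<comment> \<open>Two scaled prices differ by at most \<open>2 * q * S\<close>. The index range
    gives \<open>q \<le> 2 * n\<close>, whence the factor \<open>4 * n\<close> in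
    \<open>K\<close>.\<close>
  have bound: "2 * (int q * S) + 1 \<le> K"
    using q mult_right_mono[of "int q" "2 * int n" S] S_nonneg by (simp add: K_def mult_ac)
  have mono: "P * a < P * b + P \<Longrightarrow> a \<le> b" for a b
    using P_pos by (metis add.commute distrib_left mult.right_neutral mult_less_cancel_left_pos zle_add1_eq_le)
  have exact: "?a = p * q"
  proof (rule ccontr)
    assume "?a \<noteq> p * q"
    then have less: "int ?a \<le> int (p * q) - 1" using f(1) by linarith
    \<comment> \<open>Some competitor has to fill the capacity exactly: the first \<open>p\<close>
      items with choice \<open>First\<close>. Against it, a single lost unit costs \<open>K\<close>,
      more than any price difference can recover.\<close>
    define f0 where "f0 i = (if i \<le> p then First else Unused)" for i
    have "(\<Sum>i\<in>{1..n}. amount q j (f0 i)) = (\<Sum>i\<in>{1..n}. if i \<in> {1..p} then q else 0)"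
      by (intro sum.cong) (auto simp: f0_def)
    also have "\<dots> = (\<Sum>i\<in>{1..n} \<inter> {1..p}. q)"
      by (rule sum.inter_restrict[symmetric]) simp
    also have "{1..n} \<inter> {1..p} = {1..p}" using p_le_n by auto
    finally have "(\<Sum>i\<in>{1..n}. amount q j (f0 i)) = p * q" by simp
    from le[OF this] have "P * (K * int (p * q) - scaled_price q j f0) < P * (K * int ?a - scaled_price q j f) + P"
      using score mask_bounds[of f] mask_bounds[of f0] by linarith
    then have "K * int (p * q) - scaled_price q j f0 \<le> K * int ?a - scaled_price q j f"
      by (rule mono)
    also have "K * int ?a \<le> K * (int (p * q) - 1)"
      using less S_nonneg by (intro mult_left_mono) (auto simp: K_def)
    finally have "K \<le> scaled_price q j f0 - scaled_price q j f"
      by (simp add: right_diff_distrib)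
    then show False
      using abs_scaled_price_le[OF q(2), of f] abs_scaled_price_le[OF q(2), of f0] bound by linarith
  qed
  have pat: "pattern I q j f" using exact q by (simp add: pattern_def)
  have score': "score u = mask f + (K * int p * int q - scaled_price q j f) * P"
    using score exact by (simp add: algebra_simps)
  have "score u div P = K * int p * int q - scaled_price q j f" "score u mod P = mask f"
    unfolding score' using mask_bounds[of f] P_pos by simp_all
  moreover have "scaled_price q j f \<le> scaled_price q j f'" if "pattern I q j f'" for f'
  proof -
    have "P * (K * int (p * q) - scaled_price q j f') < P * (K * int (p * q) - scaled_price q j f) + P"
      using le[of f'] that score exact mask_bounds[of f] mask_bounds[of f'] by (simp add: pattern_def)
    from mono[OF this] show ?thesis by simp
  qed
  ultimately show thesis using that pat unfolding q_def j_def by blast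
qed

text \<open>The reward for the full capacity is at least \<open>K\<close>, which exceeds every
  scaled price. Consequently the dummy fraction \<open>0 / 1\<close>, with which the search starts,
  is beaten by the first pair.\<close>

lemma score_div_P_pos:
  assumes u: "u \<in> {1..<(n + 1) * (n + 1)}"
  shows "0 < score u div P"
proof -
  obtain f where f: "score u div P = K * int p * int (qq u) - scaled_price (qq u) (jj u) f"
    using score_attained[OF u] by blast
  have "int (qq u) * S \<le> int (2 * n) * S"
    using qq_jj[OF u] S_nonneg by (intro mult_right_mono) auto
  moreover have "0 \<le> int n * S" using S_nonneg by simp
  ultimately have 1: "int (qq u) * S < K" by (simp add: K_def)
  have "K * 1 \<le> K * (int p * int (qq u))"
    using qq_jj[OF u] p_pos S_nonneg mult_mono[of 1 "int p" 1 "int (qq u)"]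
    by (intro mult_left_mono) (auto simp: K_def)
  then show ?thesis
    using f 1 abs_scaled_price_le[OF qq_jj(2)[OF u], of f] by (simp add: mult.assoc)
qed

text \<open>Divided by \<open>q\<close>, the quotient of a score by \<open>P\<close> is the constant
  \<open>K * p\<close> minus \<open>D\<close> times a pattern value. The pair with the largest such
  ratio thus has the least pattern value; the hypothesis states this without fractions.\<close>

theorem best_score_optimal:
  assumes u: "u \<in> {1..<(n + 1) * (n + 1)}"
    and best: "\<And>u'. u' \<in> {1..<(n + 1) * (n + 1)} \<Longrightarrow>
      (score u' div P) * int (qq u) \<le> (score u div P) * int (qq u')"
  obtains x where "x \<in> first_stage I" "robust_cost I x = optimal_value I"
    "\<forall>i<n. score u mod P div 2 ^ i mod 2 = int (x (Suc i))"
    "optimal_value I = of_int (K * int p * int (qq u) - score u div P) / of_int (int (qq u) * D)"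
proof -
  obtain f where f: "pattern I (qq u) (jj u) f"
    "score u div P = K * int p * int (qq u) - scaled_price (qq u) (jj u) f"
    "score u mod P = mask f"
    using score_attained[OF u] by blast
  note q = qq_jj[OF u]
  have x: "first_items I f \<in> first_stage I"
    by (rule first_items_in_first_stage[OF f(1)])
  define v where "v = pattern_value I (qq u) (jj u) f"
  have low: "v \<le> robust_cost I x'" if x': "x' \<in> first_stage I" for x'
  proof -
    obtain q' j' f' where f': "q' \<le> n" "pattern I q' j' f'" "robust_cost I x' = pattern_value I q' j' f'"
      using robust_cost_attained[OF valid x'] by blast
    then obtain u' where u': "u' \<in> {1..<(n + 1) * (n + 1)}" "qq u' = q'" "jj u' = j'"
      using obtain_index[of q' j'] by (auto simp: pattern_def)
    obtain g where g: "score u' div P = K * int p * int q' - scaled_price q' j' g"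
        "scaled_price q' j' g \<le> scaled_price q' j' f'"
      using score_attained[OF u'(1)] u'(2,3) f'(2) by metis
    note q' = qq_jj[OF u'(1), unfolded u'(2,3)]
    have "scaled_price (qq u) (jj u) f * int q' \<le> scaled_price q' j' g * int (qq u)"
      using best[OF u'(1)] f(2) g(1) u'(2) by (simp add: algebra_simps)
    also have "\<dots> \<le> scaled_price q' j' f' * int (qq u)"
      using g(2) by (intro mult_right_mono) auto
    finally have "real_of_int (scaled_price (qq u) (jj u) f * int q')
        \<le> real_of_int (scaled_price q' j' f' * int (qq u))"
      by (simp only: of_int_le_iff)
    then have "(real (qq u) * real q' * real_of_int D) * v
        \<le> (real (qq u) * real q' * real_of_int D) * pattern_value I q' j' f'"
      by (simp add: scaled_price_pattern_value[OF q(1)] scaled_price_pattern_value[OF q'(1)] v_def mult_ac)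
    moreover have "0 < real (qq u) * real q' * real_of_int D"
      using q q' D_pos by simp
    ultimately show ?thesis
      using f'(3) by (simp only: mult_le_cancel_left_pos)
  qed
  have "robust_cost I (first_items I f) \<le> v"
    using robust_cost_le_pattern_value[OF valid f(1)] by (simp add: v_def)
  with low[OF x] have v: "robust_cost I (first_items I f) = v" by simp
  have "finite (first_stage I)"
    by (rule finite_subset[of _ "{1..items I} \<rightarrow>\<^sub>E {0, 1}"])
      (auto simp: first_stage_def intro!: finite_PiE)
  then have opt: "optimal_value I = v"
    unfolding optimal_value_def using x v low by (intro Min_eqI) auto
  have "v = of_int (scaled_price (qq u) (jj u) f) / of_int (int (qq u) * D)"
    using scaled_price_pattern_value[OF q(1), of "jj u" f] q D_pos by (simp add: v_def)
  then show thesis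
    using that[of "first_items I f"] x v opt f(2,3) mask_bit by simp
qed

end

section \<open>Input words\<close>

text \<open>Flattening the groups of three costs into one sequence lets the loops walk over
  numerator-denominator pairs uniformly.\<close>

definition input_rat :: "r2st_instance \<Rightarrow> nat \<Rightarrow> rat" where
  "input_rat I m = (if m = 0 then budget I else if m mod 3 = 1 then first_cost I (m div 3 + 1)
     else if m mod 3 = 2 then lower_cost I (m div 3 + 1) else upper_cost I (m div 3))"

lemma input_rat_simps:
  assumes "1 \<le> i"
  shows "input_rat I (3 * i - 2) = first_cost I i" "input_rat I (3 * i - 1) = lower_cost I i"
    "input_rat I (3 * i) = upper_cost I i" "input_rat I 0 = budget I"
proof -
  obtain k where i: "i = k + 1" using assms by (metis add.commute le_Suc_ex)
  have mods: "(3 * k + 1) mod 3 = 1" "(3 * k + 1) div 3 = k" "(3 * k + 2) mod 3 = 2" "(3 * k + 2) div 3 = k"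
    by presburger+
  have sub: "3 * i - 2 = 3 * k + 1" "3 * i - 1 = 3 * k + 2" using i by simp_all
  show "input_rat I (3 * i - 2) = first_cost I i" "input_rat I (3 * i - 1) = lower_cost I i"
    "input_rat I (3 * i) = upper_cost I i" "input_rat I 0 = budget I"
    unfolding sub input_rat_def mods using i by simp_all
qed

lemma encode_r2st_eq:
  "encode_r2st I = [int (items I), int (quota I)]
     @ concat (map (\<lambda>m. encode_rat (input_rat I m)) [0..<3 * items I + 1])"
proof -
  have "encode_rat (budget I) @ concat (map (\<lambda>i. encode_rat (first_cost I i) @ encode_rat (lower_cost I i)
      @ encode_rat (upper_cost I i)) [1..<k + 1]) =
    concat (map (\<lambda>m. encode_rat (input_rat I m)) [0..<3 * k + 1])" for k
  proof (induction k)
    case 0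
    then show ?case by (simp add: input_rat_def One_nat_def)
  next
    case (Suc k)
    have "3 * Suc k - 2 = 3 * k + 1" "3 * Suc k - 1 = Suc (3 * k + 1)"
      "3 * Suc k = Suc (Suc (3 * k + 1))" "3 * Suc k + 1 = Suc (Suc (Suc (3 * k + 1)))"
      by simp_all
    then have "[0..<3 * Suc k + 1] = [0..<3 * k + 1] @ [3 * Suc k - 2, 3 * Suc k - 1, 3 * Suc k]"
      by (simp only: upt_Suc) simp
    moreover have "[1..<Suc k + 1] = [1..<k + 1] @ [Suc k]"
      by simp
    ultimately show ?case
      using Suc by (simp only: map_append concat_append list.map concat.simps append_assoc
          append_Nil2 input_rat_simps[of "Suc k"])
        (simp only: append_assoc[symmetric])
  qed
  then show ?thesis by (simp add: encode_r2st_def)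
qed

lemma nth_concat_pairs:
  assumes "m < N"
  shows "concat (map (\<lambda>m. [f m, g m]) [0..<N]) ! (2 * m) = f m"
    "concat (map (\<lambda>m. [f m, g m]) [0..<N]) ! (2 * m + 1) = g m"
proof -
  have len: "length (concat (map (\<lambda>m. [f m, g m]) [0..<N])) = 2 * N" for N
    by (induction N) auto
  show "concat (map (\<lambda>m. [f m, g m]) [0..<N]) ! (2 * m) = f m"
    "concat (map (\<lambda>m. [f m, g m]) [0..<N]) ! (2 * m + 1) = g m"
    using assms by (induction N) (auto simp: nth_append len less_Suc_eq)
qed

lemma length_concat_pairs: "length (concat (map (\<lambda>m. [f m, g m]) [0..<N])) = 2 * N"
  by (induction N) auto

lemma word_size_append: "word_size (v @ w) = word_size v + word_size w"
  by (simp add: word_size_def)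

lemma word_size_concat_pairs:
  "word_size (concat (map (\<lambda>m. [f m, g m]) [0..<N])) = (\<Sum>m<N. 2 + int_size (f m) + int_size (g m))"
  by (induction N) (simp_all add: word_size_append, simp_all add: word_size_def)

locale r2st_input =
  fixes I :: r2st_instance
  assumes valid_instance: "valid_r2st I"
begin

definition num :: "nat \<Rightarrow> int" where "num m = fst (quotient_of (input_rat I m))"
definition den :: "nat \<Rightarrow> int" where "den m = snd (quotient_of (input_rat I m))"
text \<open>A plain product suffices in place of a least common multiple: the bit lengths of the
  denominators add up to at most the input size.\<close>

definition D :: int where "D = (\<Prod>m<3 * items I + 1. den m)"
definition V :: "nat \<Rightarrow> int" where "V m = num m * (D div den m)"
definition W :: nat where "W = word_size (encode_r2st I)"

lemma den_pos: "0 < den m"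
  by (simp add: den_def quotient_of_denom_pos')

lemma input_rat_eq: "input_rat I m = of_int (num m) / of_int (den m)"
  unfolding num_def den_def by (rule quotient_of_div) simp

lemma V_eq:
  assumes "m < 3 * items I + 1"
  shows "of_int (V m) = of_int D * input_rat I m"
proof -
  have "den m dvd D"
    unfolding D_def using assms by (intro dvd_prodI) auto
  then show ?thesis
    using den_pos[of m] by (auto simp: V_def input_rat_eq field_simps elim!: dvdE)
qed

sublocale scaled_instance I D V
proof
  show "valid_r2st I" by (rule valid_instance)
  show "0 < D" unfolding D_def by (intro prod_pos) (simp add: den_pos)
  show "of_int (V 0) = of_int D * budget I"
    using V_eq[of 0] by (simp add: input_rat_def)
  fix i assume i: "i \<in> {1..items I}"
  show "of_int (V (3 * i - 2)) = of_int D * first_cost I i"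
    using V_eq[of "3 * i - 2"] i by (auto simp: input_rat_simps)
  show "of_int (V (3 * i - 1)) = of_int D * lower_cost I i"
    using V_eq[of "3 * i - 1"] i by (auto simp: input_rat_simps)
  show "of_int (V (3 * i)) = of_int D * upper_cost I i"
    using V_eq[of "3 * i"] i by (auto simp: input_rat_simps)
qed

lemma encode_eq: "encode_r2st I = [int n, int p] @ concat (map (\<lambda>m. [num m, den m]) [0..<3 * n + 1])"
  unfolding encode_r2st_eq by (simp add: encode_rat_def num_def den_def)

text \<open>The input consists of two integers and \<open>3 * n + 1\<close> pairs, so this is also
  the first cell that is initially zero; the tables start here.\<close>

definition base :: nat where "base = 6 * n + 4"

lemma length_encode: "length (encode_r2st I) = base"
  by (simp add: encode_eq length_concat_pairs base_def)

lemma input_reg: "reg (input_state (encode_r2st I)) 0 = int base"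
  by (simp add: input_state_def length_encode)

lemma input_mem:
  "mem (input_state (encode_r2st I)) 0 = int n"
  "mem (input_state (encode_r2st I)) 1 = int p"
  "m < 3 * n + 1 \<Longrightarrow> mem (input_state (encode_r2st I)) (int (2 * m + 2)) = num m"
  "m < 3 * n + 1 \<Longrightarrow> mem (input_state (encode_r2st I)) (int (2 * m + 3)) = den m"
  "a \<ge> int base \<Longrightarrow> mem (input_state (encode_r2st I)) a = 0"
proof -
  have at: "mem (input_state (encode_r2st I)) (int k) = encode_r2st I ! k" if "k < base" for k
    using that by (simp add: input_state_def length_encode)
  show "mem (input_state (encode_r2st I)) 0 = int n"
    using at[of 0] by (simp add: base_def encode_eq)
  show "mem (input_state (encode_r2st I)) 1 = int p"
    using at[of 1] by (simp add: base_def encode_eq)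
  show "mem (input_state (encode_r2st I)) (int (2 * m + 2)) = num m" if "m < 3 * n + 1"
    using at[of "2 * m + 2"] that nth_concat_pairs(1)[OF that, of num den]
    by (simp add: base_def encode_eq)
  show "mem (input_state (encode_r2st I)) (int (2 * m + 3)) = den m" if "m < 3 * n + 1"
  proof -
    have "2 * m + 3 = Suc (Suc (2 * m + 1))" by simp
    then show ?thesis
      using at[of "2 * m + 3"] that nth_concat_pairs(2)[OF that, of num den]
      by (simp add: base_def encode_eq flip: Suc_eq_plus1)
  qed
  show "mem (input_state (encode_r2st I)) a = 0" if "a \<ge> int base"
    using that by (simp add: input_state_def length_encode)
qed

section \<open>Bounds on the numbers that occur\<close>

lemma W_eq: "W = 2 + int_size (int n) + int_size (int p)
    + (\<Sum>m<3 * n + 1. 2 + int_size (num m) + int_size (den m))"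
  unfolding W_def encode_eq word_size_append word_size_concat_pairs by (simp add: word_size_def)

text \<open>Each of the \<open>6 * n + 4\<close> input integers contributes at least
  \<open>2\<close>.\<close>

lemma W_ge: "12 * n + 8 \<le> W"
proof -
  have "(\<Sum>m<3 * n + 1. 4) \<le> (\<Sum>m<3 * n + 1. 2 + int_size (num m) + int_size (den m))"
  proof (intro sum_mono)
    fix m show "4 \<le> 2 + int_size (num m) + int_size (den m)"
      using int_size_pos[of "num m"] int_size_pos[of "den m"] by linarith
  qed
  then show ?thesis
    using int_size_pos[of "int n"] int_size_pos[of "int p"] by (simp add: W_eq)
qed

lemma abs_le_two_power_int_size: "\<bar>z\<bar> \<le> 2 ^ int_size z"
proof -
  have "(2::int) ^ (int_size z - 1) \<le> 2 ^ int_size z" by (rule power_increasing) simp_all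
  then show ?thesis using abs_less_two_power_int_size[of z] by linarith
qed

text \<open>The yardstick for all magnitudes: sizes are bounded by powers of \<open>B\<close>, and
  factors linear in \<open>n\<close> are absorbed by raising the exponent by one.\<close>

definition B :: int where "B = 2 ^ W"

lemma B_ge: "int W \<le> B" "12 * int n + 8 \<le> B" "1 \<le> B"
proof -
  show "int W \<le> B" unfolding B_def by (metis less_imp_le of_nat_less_two_power)
  then show "12 * int n + 8 \<le> B" using W_ge by linarith
  then show "1 \<le> B" by linarith
qed

lemma abs_input_le:
  assumes "m < 3 * n + 1"
  shows "\<bar>num m\<bar> \<le> B"
proof -
  have "2 + int_size (num m) + int_size (den m) \<le> (\<Sum>m<3 * n + 1. 2 + int_size (num m) + int_size (den m))"
    using assms by (intro member_le_sum) auto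
  then have "int_size (num m) \<le> W" by (simp add: W_eq)
  then have "2 ^ int_size (num m) \<le> B" unfolding B_def by (rule power_increasing) simp
  then show ?thesis using abs_le_two_power_int_size[of "num m"] by linarith
qed

lemma prod_den_bounds:
  assumes "k \<le> 3 * n + 1"
  shows "0 < (\<Prod>m<k. den m)" "(\<Prod>m<k. den m) \<le> B"
proof -
  show "0 < (\<Prod>m<k. den m)" by (intro prod_pos) (simp add: den_pos)
  have "(\<Prod>m<k. den m) \<le> (\<Prod>m<k. 2 ^ int_size (den m))"
    using den_pos abs_le_two_power_int_size by (intro prod_mono) (auto simp: less_imp_le dest: abs_le_D1)
  also have "\<dots> = 2 ^ (\<Sum>m<k. int_size (den m))" by (simp add: power_sum)
  also have "\<dots> \<le> B"
  proof -
    have "(\<Sum>m<k. int_size (den m)) \<le> (\<Sum>m<3 * n + 1. int_size (den m))"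
      using assms by (intro sum_mono2) auto
    also have "\<dots> \<le> (\<Sum>m<3 * n + 1. 2 + int_size (num m) + int_size (den m))"
      by (intro sum_mono) auto
    finally show ?thesis unfolding B_def by (intro power_increasing) (auto simp: W_eq)
  qed
  finally show "(\<Prod>m<k. den m) \<le> B" .
qed

lemma D_le: "D \<le> B"
  unfolding D_def by (rule prod_den_bounds) simp

lemma abs_V_le:
  assumes "m < 3 * n + 1"
  shows "\<bar>V m\<bar> \<le> B ^ 2"
proof -
  have "\<bar>D div den m\<bar> \<le> \<bar>D\<bar>" by (rule abs_div_le_abs)
  then have "\<bar>D div den m\<bar> \<le> B" using D_le D_pos by linarith
  then show ?thesis
    unfolding V_def abs_mult power2_eq_square using abs_input_le[OF assms] B_ge(3)
    by (intro mult_mono) auto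
qed

lemma sum_squares_bounds:
  assumes "k \<le> 3 * n + 1"
  shows "0 \<le> (\<Sum>m<k. V m * V m)" "(\<Sum>m<k. V m * V m) \<le> B ^ 5"
proof -
  show "0 \<le> (\<Sum>m<k. V m * V m)" by (intro sum_nonneg) simp
  have "(\<Sum>m<k. V m * V m) \<le> (\<Sum>m<k. B ^ 4)"
  proof (intro sum_mono)
    fix m assume "m \<in> {..<k}"
    then have "\<bar>V m\<bar> \<le> B ^ 2" using assms by (intro abs_V_le) auto
    then have "\<bar>V m\<bar> * \<bar>V m\<bar> \<le> B ^ 2 * B ^ 2" by (intro mult_mono) auto
    then show "V m * V m \<le> B ^ 4" by (simp flip: power_add)
  qed
  also have "\<dots> = int k * B ^ 4" by simp
  also have "\<dots> \<le> B * B ^ 4"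
    using assms B_ge by (intro mult_right_mono) auto
  also have "\<dots> = B ^ 5" by (simp add: numeral_eq_Suc)
  finally show "(\<Sum>m<k. V m * V m) \<le> B ^ 5" .
qed

lemma S_le: "S \<le> B ^ 5"
  unfolding S_def by (rule sum_squares_bounds) simp

lemma B_power_mono: "k \<le> l \<Longrightarrow> B ^ k \<le> B ^ l" "0 < B ^ k"
  using B_ge(3) by (auto intro: power_increasing)

lemma K_bounds: "0 < K" "K \<le> B ^ 6"
proof -
  show "0 < K" using S_nonneg by (simp add: K_def add_nonneg_pos)
  have "4 * int n * S + 1 \<le> 4 * int n * B ^ 5 + B ^ 5"
    using S_le B_power_mono(1)[of 0 5] by (intro add_mono mult_left_mono) auto
  also have "\<dots> = (4 * int n + 1) * B ^ 5" by (simp add: algebra_simps)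
  also have "\<dots> \<le> B * B ^ 5" using B_ge by (intro mult_right_mono) auto
  also have "\<dots> = B ^ 6" by (simp add: numeral_eq_Suc)
  finally show "K \<le> B ^ 6" by (simp add: K_def)
qed

lemma P_le: "P \<le> B"
  unfolding P_def B_def using W_ge by (intro power_increasing) auto

lemma abs_gain_le:
  assumes "j \<le> q" "q \<le> 2 * n" "i \<in> {1..n}"
  shows "\<bar>gain q j i c\<bar> \<le> B ^ 8"
proof -
  have "\<bar>price q j (V (3 * i - 2)) (V (3 * i - 1)) (V (3 * i)) c\<bar> \<le>
      int q * (V (3 * i - 2) * V (3 * i - 2) + V (3 * i - 1) * V (3 * i - 1) + V (3 * i) * V (3 * i))"
    by (rule abs_price_le[OF assms(1)])
  also have "\<dots> \<le> int q * S"
  proof (intro mult_left_mono)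
    let ?s = "\<lambda>i. V (3 * i - 2) * V (3 * i - 2) + V (3 * i - 1) * V (3 * i - 1) + V (3 * i) * V (3 * i)"
    have "?s i \<le> (\<Sum>i\<in>{1..n}. ?s i)"
      using assms(3) by (intro member_le_sum[of i]) auto
    then show "?s i \<le> S" using S_eq zero_le_square[of "V 0"] by linarith
  qed simp
  also have "\<dots> \<le> int (2 * n) * B ^ 5"
    using assms(2) S_le S_nonneg by (intro mult_mono) auto
  finally have 1: "\<bar>price q j (V (3 * i - 2)) (V (3 * i - 1)) (V (3 * i)) c\<bar> \<le> 2 * int n * B ^ 6"
    using mult_left_mono[OF B_power_mono(1)[of 5 6], of "2 * int n"] by simp
  have "amount q j c \<le> 2 * n" using assms by (cases c) auto
  then have "K * int (amount q j c) \<le> B ^ 6 * (2 * int n)"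
    using K_bounds by (intro mult_mono) auto
  moreover have "0 \<le> K * int (amount q j c)" using K_bounds by simp
  ultimately have 2: "\<bar>K * int (amount q j c) - price q j (V (3 * i - 2)) (V (3 * i - 1)) (V (3 * i)) c\<bar>
      \<le> 4 * int n * B ^ 6"
    using 1 by (simp add: algebra_simps)
  have "\<bar>P * (K * int (amount q j c) - price q j (V (3 * i - 2)) (V (3 * i - 1)) (V (3 * i)) c)\<bar>
      \<le> B * (4 * int n * B ^ 6)"
    unfolding abs_mult using 2 P_pos P_le B_ge by (intro mult_mono) auto
  also have "\<dots> = 4 * int n * B ^ 7" by (simp add: numeral_eq_Suc)
  finally have 3: "\<bar>P * (K * int (amount q j c) - price q j (V (3 * i - 2)) (V (3 * i - 1)) (V (3 * i)) c)\<bar>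
      \<le> 4 * int n * B ^ 7" .
  have "(2::int) ^ (i - 1) \<le> P"
    unfolding P_def using assms(3) by (intro power_increasing) auto
  then have "0 \<le> (if c = First then 2 ^ (i - 1) else 0 :: int) \<and>
      (if c = First then 2 ^ (i - 1) else 0) \<le> B"
    using P_le B_ge by auto
  with 3 have "\<bar>gain q j i c\<bar> \<le> 4 * int n * B ^ 7 + B"
    unfolding gain_def by linarith
  also have "\<dots> \<le> 4 * int n * B ^ 7 + B ^ 7"
    using B_power_mono(1)[of 1 7] by simp
  also have "\<dots> = (4 * int n + 1) * B ^ 7" by (simp add: algebra_simps)
  also have "\<dots> \<le> B * B ^ 7" using B_ge by (intro mult_right_mono) auto
  also have "\<dots> = B ^ 8" by (simp add: numeral_eq_Suc)
  finally show ?thesis .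
qed

lemma knap_bounds:
  assumes "j \<le> q" "q \<le> 2 * n" "k \<le> n"
  shows "0 \<le> knap q j (gain q j) k t \<and> knap q j (gain q j) k t \<le> int k * B ^ 8"
  using assms(3)
proof (induction k arbitrary: t)
  case (Suc k)
  have g: "\<bar>gain q j (Suc k) c\<bar> \<le> B ^ 8" for c
    using Suc.prems by (intro abs_gain_le assms) auto
  have IH: "0 \<le> knap q j (gain q j) k t" "knap q j (gain q j) k t \<le> int k * B ^ 8" for t
    using Suc by auto
  have imp: "0 \<le> improve d (gain q j (Suc k) c) (knap q j (gain q j) k) t v \<and>
      improve d (gain q j (Suc k) c) (knap q j (gain q j) k) t v \<le> int (Suc k) * B ^ 8"
    if "0 \<le> v \<and> v \<le> int (Suc k) * B ^ 8" for d c v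
    using that g[of c] IH[of "t - d"] by (auto simp: improve_def algebra_simps)
  have "knap q j (gain q j) k t \<le> int (Suc k) * B ^ 8"
    unfolding of_nat_Suc distrib_right using IH[of t] B_power_mono(2)[of 8] by linarith
  then show ?case
    unfolding knap.simps using IH[of t] by (intro imp) auto
qed simp

text \<open>The largest number is the output numerator, at most \<open>B ^ 11\<close>; the twelfth
  factor makes the bound strict.\<close>

definition L :: nat where "L = 12 * W"

lemma L_pos: "1 \<le> L"
  using W_ge by (simp add: L_def)

lemma two_power_L: "2 ^ L = B ^ 12"
  by (simp add: L_def B_def mult.commute flip: power_mult)

lemma less_two_power_L: "\<bar>z\<bar> \<le> B ^ 11 \<Longrightarrow> \<bar>z\<bar> < 2 ^ L"
proof -
  have "B ^ 11 * 1 < B ^ 11 * B"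
    using B_ge B_power_mono(2)[of 11] by (intro mult_strict_left_mono) auto
  then show "\<bar>z\<bar> \<le> B ^ 11 \<Longrightarrow> \<bar>z\<bar> < 2 ^ L"
    by (simp add: two_power_L numeral_eq_Suc)
qed

lemma less_two_power_L_mono: "\<bar>z\<bar> \<le> B ^ k \<Longrightarrow> k \<le> 11 \<Longrightarrow> \<bar>z\<bar> < 2 ^ L"
  using less_two_power_L B_power_mono(1) order_trans by blast

lemma knap_gain_less:
  assumes "j \<le> q" "q \<le> 2 * n" "k < n"
  shows "\<bar>knap q j (gain q j) k t + gain q j (Suc k) c\<bar> < 2 ^ L"
proof (rule less_two_power_L_mono)
  have "\<bar>gain q j (Suc k) c\<bar> \<le> B ^ 8" using assms by (intro abs_gain_le) auto
  then have "\<bar>knap q j (gain q j) k t + gain q j (Suc k) c\<bar> \<le> (int k + 1) * B ^ 8"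
    using knap_bounds[OF assms(1,2), of k t] assms(3) by (auto simp: algebra_simps)
  also have "\<dots> \<le> B * B ^ 8" using B_ge assms(3) by (intro mult_right_mono) auto
  finally show "\<bar>knap q j (gain q j) k t + gain q j (Suc k) c\<bar> \<le> B ^ 9" by (simp add: numeral_eq_Suc)
qed simp

lemma abs_score_le:
  assumes u: "u \<in> {1..<(n + 1) * (n + 1)}"
  shows "\<bar>score u\<bar> \<le> B ^ 10"
proof -
  note q = qq_jj[OF u]
  have "int n * B ^ 8 \<le> B * B ^ 8" using B_ge by (intro mult_right_mono) auto
  then have 1: "\<bar>knap (qq u) (jj u) (gain (qq u) (jj u)) n (p * qq u)\<bar> \<le> B ^ 9"
    using knap_bounds[OF q(2,3), of n "p * qq u"] by (simp add: numeral_eq_Suc)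
  have "\<bar>P * int (jj u) * V 0\<bar> \<le> B * B * B ^ 2"
    unfolding abs_mult using abs_V_le[of 0] P_pos P_le B_ge q by (intro mult_mono) auto
  also have "\<dots> = B ^ 4" by (simp add: numeral_eq_Suc)
  also have "\<dots> \<le> B ^ 9" by (rule B_power_mono) simp
  finally have "\<bar>score u\<bar> \<le> 2 * B ^ 9" using 1 unfolding score_def by linarith
  also have "\<dots> \<le> B * B ^ 9" using B_ge by (intro mult_right_mono) auto
  finally show ?thesis by (simp add: numeral_eq_Suc)
qed

lemma initial_bounded: "bounded L (input_state (encode_r2st I))"
proof -
  have z: "\<bar>z\<bar> < 2 ^ L" if "z \<in> set (encode_r2st I)" for z
  proof -
    have "1 + int_size z \<le> W"
      unfolding W_def word_size_def using that by (intro member_le_sum_list) auto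
    then have "int_size z \<le> Suc L" by (simp add: L_def)
    then show ?thesis by (simp add: int_size_le_iff)
  qed
  have "int base \<le> B" using B_ge by (simp add: base_def)
  then have "\<bar>int base\<bar> < 2 ^ L" using less_two_power_L_mono[of "int base" 1] by simp
  then show ?thesis
    unfolding bounded_def input_state_def using z by (auto simp: length_encode)
qed

end

section \<open>The program\<close>

text \<open>Registers: \<open>0\<close> length of the input, \<open>1\<close> number of items, \<open>2\<close> quota, \<open>3\<close> common denominator,
  \<open>4\<close> mask bound \<open>P\<close>, \<open>5\<close> sum of squares, then reward \<open>K\<close>, \<open>6\<close> index \<open>u\<close> of the pair \<open>(q, j)\<close>,
  \<open>7\<close> \<open>j\<close>, \<open>8\<close> \<open>q\<close>, \<open>9\<close> address of the table, \<open>10\<close> input pointer, \<open>11\<close> mask bit of the current item,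
  \<open>12\<close> capacity, \<open>13\<close> best score, \<open>14\<close> its \<open>q\<close>, \<open>15\<close> current score.\<close>

definition denominators_loop :: program where
  "denominators_loop = WhilePos (Minus (Reg 0) (Reg 10))
     (Seq (Assign 3 (Times (Reg 3) (Mem (Plus (Reg 10) (Const 1)))))
     (Seq (Assign 4 (Plus (Reg 4) (Reg 4)))
          (Assign 10 (Plus (Reg 10) (Const 2)))))"

definition scaling_loop :: program where
  "scaling_loop = WhilePos (Minus (Reg 0) (Reg 10))
     (Seq (Store (Reg 10) (Times (Mem (Reg 10)) (Div (Reg 3) (Mem (Plus (Reg 10) (Const 1))))))
     (Seq (Assign 5 (Plus (Reg 5) (Times (Mem (Reg 10)) (Mem (Reg 10)))))
          (Assign 10 (Plus (Reg 10) (Const 2)))))"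

text \<open>One \<open>improve\<close> step on the table cell of the current capacity. Guards only
  test positivity, so \<open>d \<le> t\<close> is expressed as \<open>t + 1 - d > 0\<close>.\<close>

definition relax :: "expr \<Rightarrow> expr \<Rightarrow> program" where
  "relax d e = IfPos (Minus (Plus (Reg 12) (Const 1)) d)
     (IfPos (Minus (Plus (Mem (Minus (Plus (Reg 9) (Reg 12)) d)) e) (Mem (Plus (Reg 9) (Reg 12))))
        (Store (Plus (Reg 9) (Reg 12)) (Plus (Mem (Minus (Plus (Reg 9) (Reg 12)) d)) e))
        Skip)
     Skip"

definition partial_gain :: expr where
  "partial_gain = Times (Reg 4) (Minus (Times (Reg 5) (Reg 7))
     (Times (Reg 7) (Mem (Plus (Reg 10) (Const 2)))))"

definition recourse_gain :: expr where
  "recourse_gain = Times (Reg 4) (Minus (Times (Reg 5) (Reg 8))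
     (Plus (Times (Reg 7) (Mem (Plus (Reg 10) (Const 2))))
           (Times (Minus (Reg 8) (Reg 7)) (Mem (Plus (Reg 10) (Const 4))))))"

definition first_gain :: expr where
  "first_gain = Plus (Times (Reg 4) (Minus (Times (Reg 5) (Reg 8)) (Times (Reg 8) (Mem (Reg 10)))))
     (Reg 11)"

text \<open>The capacities are visited downwards, so that the entries read still belong to the previous
  item and one table suffices.\<close>
definition capacity_loop :: program where
  "capacity_loop = WhilePos (Reg 12)
     (Seq (Assign 12 (Minus (Reg 12) (Const 1)))
     (Seq (relax (Reg 7) partial_gain)
     (Seq (relax (Reg 8) recourse_gain)
          (relax (Reg 8) first_gain))))"

text \<open>Register \<open>12\<close> starts one above the capacity because
  \<open>capacity_loop\<close> decrements before it relaxes. An item occupies six cells, the first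
  item starting at cell \<open>4\<close>.\<close>

definition item_loop :: program where
  "item_loop = WhilePos (Minus (Reg 0) (Reg 10))
     (Seq (Assign 12 (Plus (Times (Reg 2) (Reg 8)) (Const 1)))
     (Seq capacity_loop
     (Seq (Assign 11 (Plus (Reg 11) (Reg 11)))
          (Assign 10 (Plus (Reg 10) (Const 6))))))"

definition compare :: program where
  "compare = IfPos (Minus (Times (Div (Reg 15) (Reg 4)) (Reg 14)) (Times (Div (Reg 13) (Reg 4)) (Reg 8)))
     (Seq (Assign 13 (Reg 15)) (Assign 14 (Reg 8)))
     Skip"

text \<open>The remainder \<open>j\<close> is obtained from a quotient. The table stride
  \<open>2 * n\<^sup>2 + 1\<close> leaves room for all capacities up to \<open>p * q\<close>, as
  \<open>p \<le> n\<close> and \<open>q \<le> 2 * n\<close>.\<close>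

definition pair_body :: program where
  "pair_body =
     Seq (Assign 7 (Minus (Reg 6) (Times (Plus (Reg 1) (Const 1)) (Div (Reg 6) (Plus (Reg 1) (Const 1))))))
     (Seq (Assign 8 (Plus (Reg 7) (Div (Reg 6) (Plus (Reg 1) (Const 1)))))
     (Seq (Assign 9 (Plus (Reg 0) (Times (Reg 6) (Plus (Times (Const 2) (Times (Reg 1) (Reg 1))) (Const 1)))))
     (Seq (Assign 10 (Const 4))
     (Seq (Assign 11 (Const 1))
     (Seq item_loop
     (Seq (Assign 15 (Minus (Mem (Plus (Reg 9) (Times (Reg 2) (Reg 8))))
             (Times (Times (Reg 4) (Reg 7)) (Mem (Const 2)))))
     (Seq compare
          (Assign 6 (Plus (Reg 6) (Const 1))))))))))"

definition pair_loop :: program where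
  "pair_loop = WhilePos (Minus (Times (Plus (Reg 1) (Const 1)) (Plus (Reg 1) (Const 1))) (Reg 6)) pair_body"

definition output_loop :: program where
  "output_loop = WhilePos (Minus (Reg 1) (Reg 10))
     (Seq (Store (Reg 10) (Minus (Reg 8) (Times (Const 2) (Div (Reg 8) (Const 2)))))
     (Seq (Assign 8 (Div (Reg 8) (Const 2)))
          (Assign 10 (Plus (Reg 10) (Const 1)))))"

definition read_phase :: program where
  "read_phase =
     Seq (Assign 1 (Mem (Const 0)))
     (Seq (Assign 2 (Mem (Const 1)))
     (Seq (Assign 3 (Const 1))
     (Seq (Assign 4 (Const 1))
     (Seq (Assign 10 (Const 2))
     (Seq denominators_loop
     (Seq (Assign 10 (Const 2))
     (Seq (Assign 5 (Const 0))
     (Seq scaling_loop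
          (Assign 5 (Plus (Times (Times (Const 4) (Reg 1)) (Reg 5)) (Const 1)))))))))))"

definition search_phase :: program where
  "search_phase =
     Seq (Assign 6 (Const 1))
     (Seq (Assign 13 (Const 0))
     (Seq (Assign 14 (Const 1))
          pair_loop))"

definition write_phase :: program where
  "write_phase =
     Seq (Assign 7 (Div (Reg 13) (Reg 4)))
     (Seq (Assign 8 (Minus (Reg 13) (Times (Reg 4) (Reg 7))))
     (Seq (Assign 10 (Const 0))
     (Seq output_loop
     (Seq (Store (Reg 1) (Minus (Times (Times (Reg 5) (Reg 2)) (Reg 14)) (Reg 7)))
     (Seq (Store (Plus (Reg 1) (Const 1)) (Times (Reg 14) (Reg 3)))
          (Assign 0 (Plus (Reg 1) (Const 2))))))))"

definition selection_program :: program where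
  "selection_program = Seq read_phase (Seq search_phase write_phase)"

section \<open>Correctness of the program and size of its values\<close>

lemma wp_relax:
  assumes d: "eval_expr d s = int dd" and e: "eval_expr e s = ee"
    and t: "reg s 12 = int t" and A: "reg s 9 = a"
    and bd: "dd \<le> t \<Longrightarrow> \<bar>mem s (a + int t - int dd) + ee\<bar> < 2 ^ L"
    and Q: "Q (s\<lparr>mem := (mem s)(a + int t := if dd \<le> t then
      max (mem s (a + int t)) (mem s (a + int t - int dd) + ee) else mem s (a + int t))\<rparr>)"
  shows "wp X L (relax d e) Q s"
  unfolding relax_def
proof (intro wp_IfPos)
  assume "0 < eval_expr (Minus (Plus (Reg 12) (Const 1)) d) s"
    "0 < eval_expr (Minus (Plus (Mem (Minus (Plus (Reg 9) (Reg 12)) d)) e) (Mem (Plus (Reg 9) (Reg 12)))) s"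
  then show "wp X L (Store (Plus (Reg 9) (Reg 12)) (Plus (Mem (Minus (Plus (Reg 9) (Reg 12)) d)) e)) Q s"
    using bd Q by (intro wp_Store) (simp_all add: d e t A max_def)
next
  assume "0 < eval_expr (Minus (Plus (Reg 12) (Const 1)) d) s"
    "\<not> 0 < eval_expr (Minus (Plus (Mem (Minus (Plus (Reg 9) (Reg 12)) d)) e) (Mem (Plus (Reg 9) (Reg 12)))) s"
  then show "wp X L Skip Q s"
    using Q by (intro wp_Skip) (simp add: d e t A max_def split: if_splits)
next
  assume "\<not> 0 < eval_expr (Minus (Plus (Reg 12) (Const 1)) d) s"
  then show "wp X L Skip Q s"
    using Q by (intro wp_Skip) (simp add: d t A)
qed

context r2st_input
begin

text \<open>Every loop runs at most quadratically often in \<open>n\<close>, and \<open>n\<close> is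
  at most the input size.\<close>

definition X :: nat where "X = W * W"

lemma X_ge: "(n + 1) * (n + 1) \<le> X" "2 * (n * n) + 1 \<le> X" "3 * n + 1 \<le> X" "n + 2 \<le> X"
proof -
  have "(12 * n + 8) * (12 * n + 8) \<le> X"
    unfolding X_def using W_ge by (intro mult_le_mono)
  then have *: "144 * (n * n) + 192 * n + 64 \<le> X" by (simp add: algebra_simps)
  then show "(n + 1) * (n + 1) \<le> X" by (simp add: algebra_simps)
  show "2 * (n * n) + 1 \<le> X" "3 * n + 1 \<le> X" "n + 2 \<le> X" using * by linarith+
qed

lemma capacity_le:
  assumes "q \<le> 2 * n"
  shows "p * q \<le> 2 * (n * n)"
  using mult_le_mono[OF p_le_n assms] by simp

text \<open>The polynomial is chosen to cover all counters, capacities, indices of pairs and input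
  addresses at once; only table addresses need a separate estimate.\<close>

lemma int_le_X_bound: "m \<le> 2 * (n * n) + 8 * n + 8 \<Longrightarrow> int m \<le> B ^ 2"
proof -
  assume "m \<le> 2 * (n * n) + 8 * n + 8"
  moreover have "(12 * int n + 8) * (12 * int n + 8) \<le> B ^ 2"
    unfolding power2_eq_square using B_ge by (intro mult_mono) auto
  then have "144 * (int n * int n) + 192 * int n + 64 \<le> B ^ 2" by (simp add: algebra_simps)
  moreover have "0 \<le> int n * int n" by simp
  moreover have "int m \<le> 2 * (int n * int n) + 8 * int n + 8"
    using calculation(1) by (simp flip: of_nat_mult of_nat_add)
  ultimately show "int m \<le> B ^ 2" by linarith
qed

lemma small: "m \<le> 2 * (n * n) + 8 * n + 8 \<Longrightarrow> \<bar>int m\<bar> < 2 ^ L"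
  using int_le_X_bound[of m] less_two_power_L_mono[of "int m" 2] by simp

definition header :: "ram_state \<Rightarrow> bool" where
  "header s \<longleftrightarrow> reg s 0 = int base \<and> reg s 1 = int n \<and> reg s 2 = int p"

definition scaled :: "ram_state \<Rightarrow> bool" where
  "scaled s \<longleftrightarrow> header s \<and> reg s 3 = D \<and> reg s 4 = P \<and> reg s 5 = K \<and>
     (\<forall>m<3 * n + 1. mem s (int (2 * m + 2)) = V m)"

lemma wp_denominators_loop:
  assumes "header s" "reg s 3 = 1" "reg s 4 = 1" "reg s 10 = 2"
    "\<And>m. m < 3 * n + 1 \<Longrightarrow> mem s (int (2 * m + 3)) = den m"
    and Q: "\<And>s'. header s' \<Longrightarrow> reg s' 3 = D \<Longrightarrow> reg s' 4 = P \<Longrightarrow> mem s' = mem s \<Longrightarrow> Q s'"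
  shows "wp X L denominators_loop Q s"
  unfolding denominators_loop_def
proof (rule wp_WhilePos[where N = "3 * n + 1" and Inv = "\<lambda>i s'. header s' \<and> mem s' = mem s \<and>
    reg s' 3 = (\<Prod>m<i. den m) \<and> reg s' 4 = 2 ^ i \<and> reg s' 10 = int (2 * i + 2)"], goal_cases)
  case 1 show ?case by (rule X_ge)
next
  case 2 show ?case using assms by simp
next
  case (3 i s')
  have m: "mem s' (int (2 * i + 2) + 1) = den i"
    using 3 assms(5)[of i] by (simp add: add.commute)
  have "\<bar>\<Prod>m<Suc i. den m\<bar> \<le> B ^ 1"
    using prod_den_bounds[of "Suc i"] 3 by simp
  then have b1: "\<bar>(\<Prod>m<i. den m) * den i\<bar> < 2 ^ L"
    using less_two_power_L_mono[of "\<Prod>m<Suc i. den m" 1] by simp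
  have "(2::int) ^ Suc i \<le> P" unfolding P_def using 3(1) by (intro power_increasing) auto
  then have b2: "\<bar>2 ^ i + 2 ^ i :: int\<bar> < 2 ^ L"
    using less_two_power_L_mono[of "2 ^ Suc i" 1] P_le by simp
  have b3: "\<bar>int (2 * i + 4)\<bar> < 2 ^ L" using 3(1) by (intro small) simp
  show ?case
    using 3 m b1 b2 b3
    by (auto simp: header_def base_def intro!: wp_Seq wp_Assign)
next
  case (4 s')
  then show ?case using Q[of s'] by (simp add: header_def base_def D_def P_def)
qed

lemma wp_scaling_loop:
  assumes "header s" "reg s 3 = D" "reg s 4 = P" "reg s 5 = 0" "reg s 10 = 2"
    "\<And>m. m < 3 * n + 1 \<Longrightarrow> mem s (int (2 * m + 2)) = num m"
    "\<And>m. m < 3 * n + 1 \<Longrightarrow> mem s (int (2 * m + 3)) = den m"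
    and Q: "\<And>s'. header s' \<Longrightarrow> reg s' 3 = D \<Longrightarrow> reg s' 4 = P \<Longrightarrow> reg s' 5 = S \<Longrightarrow>
      (\<And>m. m < 3 * n + 1 \<Longrightarrow> mem s' (int (2 * m + 2)) = V m) \<Longrightarrow>
      (\<And>a. a \<ge> int base \<Longrightarrow> mem s' a = mem s a) \<Longrightarrow> Q s'"
  shows "wp X L scaling_loop Q s"
  unfolding scaling_loop_def
proof (rule wp_WhilePos[where N = "3 * n + 1" and Inv = "\<lambda>i s'. header s' \<and>
    reg s' 3 = D \<and> reg s' 4 = P \<and> reg s' 5 = (\<Sum>m<i. V m * V m) \<and> reg s' 10 = int (2 * i + 2) \<and>
    (\<forall>m<i. mem s' (int (2 * m + 2)) = V m) \<and> (\<forall>a \<ge> int (2 * i + 2). mem s' a = mem s a)"], goal_cases)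
  case 1 show ?case by (rule X_ge)
next
  case 2 show ?case using assms by simp
next
  case (3 i s')
  have m: "mem s' (int (2 * i + 2)) = num i" "mem s' (int (2 * i + 2) + 1) = den i"
    using 3 assms(6,7)[of i] by (simp_all add: add.commute)
  have b1: "\<bar>num i * (D div den i)\<bar> < 2 ^ L"
    using less_two_power_L_mono[OF abs_V_le[of i]] 3(1) by (simp add: V_def)
  have b2: "\<bar>(\<Sum>m<i. V m * V m) + V i * V i\<bar> < 2 ^ L"
    using less_two_power_L_mono[of "\<Sum>m<Suc i. V m * V m" 5] sum_squares_bounds[of "Suc i"] 3(1) by simp
  have b3: "\<bar>int (2 * i + 4)\<bar> < 2 ^ L" using 3(1) by (intro small) simp
  show ?case
    using 3 m b1 b2 b3
    by (auto simp: header_def base_def V_def less_Suc_eq intro!: wp_Seq wp_Assign wp_Store)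
next
  case (4 s')
  then show ?case using Q[of s'] by (simp add: header_def base_def S_def)
qed

lemma wp_read_phase:
  assumes Q: "\<And>s. scaled s \<Longrightarrow> (\<And>a. a \<ge> int base \<Longrightarrow> mem s a = 0) \<Longrightarrow> Q s"
  shows "wp X L read_phase Q (input_state (encode_r2st I))"
proof -
  have b: "\<bar>int n\<bar> < 2 ^ L" "\<bar>int p\<bar> < 2 ^ L" "\<bar>2\<bar> < (2::int) ^ L" "\<bar>1\<bar> < (2::int) ^ L" "\<bar>0\<bar> < (2::int) ^ L"
    using small[of n] small[of p] small[of 2] small[of 1] p_le_n by auto
  have Kb: "\<bar>4 * int n * S + 1\<bar> < 2 ^ L"
    using less_two_power_L_mono[of K 6] K_bounds by (simp add: K_def)
  let ?c4 = "Assign 5 (Plus (Times (Times (Const 4) (Reg 1)) (Reg 5)) (Const 1))"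
  have c4: "wp X L ?c4 Q s"
    if "header s" "reg s 3 = D" "reg s 4 = P" "reg s 5 = S"
      "\<And>m. m < 3 * n + 1 \<Longrightarrow> mem s (int (2 * m + 2)) = V m" "\<And>a. a \<ge> int base \<Longrightarrow> mem s a = 0" for s
    using that Kb by (intro wp_Assign Q) (auto simp: header_def scaled_def K_def)
  let ?c3 = "Seq (Assign 10 (Const 2)) (Seq (Assign 5 (Const 0)) (Seq scaling_loop ?c4))"
  have c3: "wp X L ?c3 Q s"
    if "header s" "reg s 3 = D" "reg s 4 = P" "mem s = mem (input_state (encode_r2st I))" for s
    by (intro wp_Seq wp_Assign; (rule wp_scaling_loop)?)
      (use that b input_mem in \<open>auto simp: header_def intro!: c4\<close>)
  have c2: "wp X L (Seq denominators_loop ?c3) Q s"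
    if "header s" "reg s 3 = 1" "reg s 4 = 1" "reg s 10 = 2" "mem s = mem (input_state (encode_r2st I))" for s
    using that input_mem by (intro wp_Seq wp_denominators_loop c3) auto
  show ?thesis
    unfolding read_phase_def
    by (intro wp_Seq[of _ _ "Assign r e" for r e] wp_Assign c2)
      (use b in \<open>simp_all add: input_mem input_reg header_def\<close>)
qed

text \<open>Every \<open>u\<close> has its own table, in cells that are still zero and hence need no initialisation.\<close>
definition table :: "nat \<Rightarrow> nat" where "table u = base + u * (2 * (n * n) + 1)"

section \<open>The dynamic programming table of one pair\<close>

lemma scaled_cong:
  assumes "scaled s" "\<And>r. r \<le> 5 \<Longrightarrow> reg s' r = reg s r" "\<And>a. a < int base \<Longrightarrow> mem s' a = mem s a"
  shows "scaled s'"
  using assms by (auto simp: scaled_def header_def base_def)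

text \<open>During the loop the table holds two rows at once: the new one at capacities already
  visited, the old one below them. Every value read at a smaller capacity therefore belongs to the
  old row.\<close>

lemma wp_capacity_loop:
  fixes u :: nat
  defines "q \<equiv> qq u" and "j \<equiv> jj u"
  defines "T \<equiv> \<lambda>k. knap q j (gain q j) k"
  assumes u: "u \<in> {1..<(n + 1) * (n + 1)}" and k: "k < n" and sc: "scaled s"
    and regs: "reg s 7 = int j" "reg s 8 = int q" "reg s 9 = int (table u)" "reg s 10 = int (6 * k + 4)"
      "reg s 11 = 2 ^ k" "reg s 12 = int (p * q + 1)"
    and tab: "\<And>t. t \<le> p * q \<Longrightarrow> mem s (int (table u + t)) = T k t"
    and Q: "\<And>s'. (\<And>r. r \<noteq> 12 \<Longrightarrow> reg s' r = reg s r) \<Longrightarrow>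
      (\<And>t. t \<le> p * q \<Longrightarrow> mem s' (int (table u + t)) = T (Suc k) t) \<Longrightarrow>
      (\<And>a. a < int (table u) \<or> a > int (table u + p * q) \<Longrightarrow> mem s' a = mem s a) \<Longrightarrow> Q s'"
  shows "wp X L capacity_loop Q s"
  unfolding capacity_loop_def
proof (rule wp_WhilePos[where N = "p * q + 1" and Inv = "\<lambda>i s'. (\<forall>r. r \<noteq> 12 \<longrightarrow> reg s' r = reg s r) \<and>
    reg s' 12 = int (p * q + 1 - i) \<and>
    (\<forall>t\<le>p * q. mem s' (int (table u + t)) = (if p * q + 1 - i \<le> t then T (Suc k) t else T k t)) \<and>
    (\<forall>a. a < int (table u) \<or> a > int (table u + p * q) \<longrightarrow> mem s' a = mem s a)"], goal_cases)
  case 1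
  have "q \<le> 2 * n" using qq_jj[OF u] by (simp add: q_def)
  then show ?case using capacity_le X_ge(2) by (meson add_le_mono1 order_trans)
next
  case 2 show ?case using regs tab by auto
next
  case (3 i s')
  have q: "1 \<le> q" "j \<le> q" "q \<le> 2 * n" using qq_jj[OF u] by (auto simp: q_def j_def)
  define t where "t = p * q - i"
  have t: "p * q + 1 - i = t + 1" "p * q + 1 - Suc i = t" "t \<le> p * q" using 3(1) by (auto simp: t_def)
  have old: "mem s' (int (table u + t')) = T k t'" if "t' \<le> p * q" "t' \<le> t" for t'
    using 3(2) that unfolding t(1) by auto
  \<comment> \<open>Between the three relaxations only the cell of capacity \<open>t\<close>
    changes; \<open>R v\<close> says that it currently holds \<open>v\<close>.\<close>
  define R :: "int \<Rightarrow> ram_state \<Rightarrow> bool" where "R v s'' \<longleftrightarrow> (\<forall>r. r \<noteq> 12 \<longrightarrow> reg s'' r = reg s r) \<and> reg s'' 12 = int t \<and>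
    mem s'' = (mem s')(int (table u + t) := v)" for v s''
  have base_table: "base \<le> table u" by (simp add: table_def)
  have V: "mem s'' (int (6 * k + 4)) = V (3 * Suc k - 2)" "mem s'' (int (6 * k + 4) + 2) = V (3 * Suc k - 1)"
      "mem s'' (int (6 * k + 4) + 4) = V (3 * Suc k)" if "R v s''" for v s''
  proof -
    have "mem s'' (int (2 * m + 2)) = V m" if "m < 3 * n + 1" for m
    proof -
      have "int (2 * m + 2) < int (table u)" using that base_table by (simp add: base_def)
      then show ?thesis
        using \<open>R v s''\<close> 3(2) sc that by (auto simp: R_def scaled_def)
    qed
    note * = this[of "3 * k + 1"] this[of "3 * k + 2"] this[of "3 * k + 3"]
    have "int (2 * (3 * k + 1) + 2) = int (6 * k + 4)" "int (2 * (3 * k + 2) + 2) = int (6 * k + 4) + 2"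
      "int (2 * (3 * k + 3) + 2) = int (6 * k + 4) + 4" "3 * Suc k - 2 = 3 * k + 1"
      "3 * Suc k - 1 = 3 * k + 2" "3 * Suc k = 3 * k + 3" by simp_all
    then show "mem s'' (int (6 * k + 4)) = V (3 * Suc k - 2)" "mem s'' (int (6 * k + 4) + 2) = V (3 * Suc k - 1)"
      "mem s'' (int (6 * k + 4) + 4) = V (3 * Suc k)"
      using * k by (simp_all only:)
  qed
  have regs': "reg s'' 4 = P" "reg s'' 5 = K" "reg s'' 7 = int j" "reg s'' 8 = int q"
      "reg s'' 9 = int (table u)" "reg s'' 10 = int (6 * k + 4)" "reg s'' 11 = 2 ^ k" "reg s'' 12 = int t"
    if "R v s''" for v s''
    using that regs sc by (auto simp: R_def scaled_def)
  have gains: "eval_expr partial_gain s'' = gain q j (Suc k) Partial"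
      "eval_expr recourse_gain s'' = gain q j (Suc k) Recourse"
      "eval_expr first_gain s'' = gain q j (Suc k) First" if "R v s''" for v s''
    by (simp_all only: partial_gain_def recourse_gain_def first_gain_def eval_expr.simps
        regs'[OF that] V[OF that] gain_def amount.simps price.simps choice.simps simp_thms if_True if_False
        diff_Suc_1 add_0_right)
  \<comment> \<open>A positive length \<open>dd\<close> reads an untouched cell. Length
    \<open>0\<close>, possible for \<open>Partial\<close> when \<open>j = 0\<close>, reads cell
    \<open>t\<close> itself, which is correct only while it still holds the old entry.\<close>
  have step: "wp X L (relax d e) (R (improve dd (gain q j (Suc k) c) (T k) t v)) s''"
    if R: "R v s''" and d: "eval_expr d s'' = int dd" and e: "eval_expr e s'' = gain q j (Suc k) c"
      and dd: "1 \<le> dd \<or> v = T k t" for v s'' d dd e c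
  proof (rule wp_relax[where a = "int (table u)"])
    show "reg s'' 12 = int t" "reg s'' 9 = int (table u)" by (simp_all add: regs'[OF R])
    have cell: "mem s'' (int (table u) + int t - int dd) = T k (t - dd)" if "dd \<le> t"
    proof (cases "dd = 0")
      case True
      then show ?thesis using R dd by (simp add: R_def)
    next
      case False
      have "int (table u) + int t - int dd = int (table u + (t - dd))" using that by simp
      moreover have "mem s' (int (table u + (t - dd))) = T k (t - dd)"
        using old[of "t - dd"] t(3) by simp
      ultimately show ?thesis using R False that by (auto simp: R_def)
    qed
    show "\<bar>mem s'' (int (table u) + int t - int dd) + gain q j (Suc k) c\<bar> < 2 ^ L" if "dd \<le> t"
      unfolding cell[OF that] T_def using knap_gain_less q k by blast
    have "mem s'' (int (table u) + int t) = v" using R by (simp add: R_def)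
    then show "R (improve dd (gain q j (Suc k) c) (T k) t v)
        (s''\<lparr>mem := (mem s'')(int (table u) + int t := if dd \<le> t then
          max (mem s'' (int (table u) + int t))
            (mem s'' (int (table u) + int t - int dd) + gain q j (Suc k) c)
          else mem s'' (int (table u) + int t))\<rparr>)"
      using R cell by (simp add: R_def improve_def)
  qed (use d e in auto)
  have "T k t = mem s' (int (table u + t))" using old[of t] t(3) by simp
  then have start: "R (T k t) (s'\<lparr>reg := (reg s')(12 := int t)\<rparr>)"
    using 3(2) by (simp add: R_def)
  define v1 where "v1 = improve j (gain q j (Suc k) Partial) (T k) t (T k t)"
  define v2 where "v2 = improve q (gain q j (Suc k) Recourse) (T k) t v1"
  have v3: "T (Suc k) t = improve q (gain q j (Suc k) First) (T k) t v2"
    by (simp add: v1_def v2_def T_def)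
  have r3: "wp X L (relax (Reg 8) first_gain) (R (T (Suc k) t)) s''" if R: "R v2 s''" for s''
    unfolding v3 by (rule step[OF R _ gains(3)[OF R]]) (simp_all add: regs'[OF R] q)
  have r2: "wp X L (Seq (relax (Reg 8) recourse_gain) (relax (Reg 8) first_gain)) (R (T (Suc k) t)) s''"
    if R: "R v1 s''" for s''
  proof (rule wp_Seq, rule wp_mono)
    show "wp X L (relax (Reg 8) recourse_gain) (R v2) s''"
      unfolding v2_def by (rule step[OF R _ gains(2)[OF R]]) (simp_all add: regs'[OF R] q)
  qed (rule r3)
  have r1: "wp X L (Seq (relax (Reg 7) partial_gain) (Seq (relax (Reg 8) recourse_gain) (relax (Reg 8) first_gain)))
    (R (T (Suc k) t)) s''" if R: "R (T k t) s''" for s''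
  proof (rule wp_Seq, rule wp_mono)
    show "wp X L (relax (Reg 7) partial_gain) (R v1) s''"
      unfolding v1_def by (rule step[OF R _ gains(1)[OF R]]) (simp_all add: regs'[OF R])
  qed (rule r2)
  have final: "(\<forall>r. r \<noteq> 12 \<longrightarrow> reg s'' r = reg s r) \<and>
    reg s'' 12 = int (p * q + 1 - Suc i) \<and>
    (\<forall>t\<le>p * q. mem s'' (int (table u + t)) = (if p * q + 1 - Suc i \<le> t then T (Suc k) t else T k t)) \<and>
    (\<forall>a. a < int (table u) \<or> a > int (table u + p * q) \<longrightarrow> mem s'' a = mem s a)"
    if R: "R (T (Suc k) t) s''" for s''
  proof (intro conjI allI impI)
    show "reg s'' r = reg s r" if "r \<noteq> 12" for r using R that by (simp add: R_def)
    show "reg s'' 12 = int (p * q + 1 - Suc i)" unfolding t(2) using R by (simp add: R_def)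
    show "mem s'' (int (table u + t')) = (if p * q + 1 - Suc i \<le> t' then T (Suc k) t' else T k t')"
      if "t' \<le> p * q" for t'
    proof (cases "t' = t")
      case False
      have "mem s' (int (table u + t')) = (if t + 1 \<le> t' then T (Suc k) t' else T k t')"
        using 3(2) that unfolding t(1) by blast
      then show ?thesis unfolding t(2) using R False by (auto simp: R_def)
    qed (use R in \<open>simp add: R_def t(2)\<close>)
    show "mem s'' a = mem s a" if "a < int (table u) \<or> a > int (table u + p * q)" for a
    proof -
      have "int (table u + t) \<le> int (table u + p * q)"
        unfolding of_nat_le_iff using t(3) by simp
      then have "a \<noteq> int (table u + t)" using that by auto
      then have "mem s'' a = mem s' a" using R by (simp add: R_def)
      also have "\<dots> = mem s a" using 3(2) that by blast
      finally show ?thesis .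
    qed
  qed
  have t': "reg s' 12 - 1 = int t" "0 < reg s' 12" using 3(2) t(1) by simp_all
  moreover have "\<bar>int t\<bar> < 2 ^ L"
    using small[of t] t(3) capacity_le[OF q(3)] by simp
  ultimately show ?case
    by (intro conjI wp_Seq[of _ _ "Assign 12 e" for e] wp_Assign)
      (simp_all only: eval_expr.simps wp_mono[OF r1[OF start] final])
next
  case (4 s')
  then have "Q s'" by (intro Q) auto
  then show ?case using 4 by simp
qed


lemma wp_item_loop:
  fixes u :: nat
  defines "q \<equiv> qq u" and "j \<equiv> jj u"
  assumes u: "u \<in> {1..<(n + 1) * (n + 1)}" and sc: "scaled s"
    and regs: "reg s 7 = int j" "reg s 8 = int q" "reg s 9 = int (table u)" "reg s 10 = 4" "reg s 11 = 1"
    and zero: "\<And>a. a \<ge> int (table u) \<Longrightarrow> mem s a = 0"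
    and Q: "\<And>s'. (\<And>r. r \<notin> {10, 11, 12} \<Longrightarrow> reg s' r = reg s r) \<Longrightarrow>
      mem s' (int (table u + p * q)) = knap q j (gain q j) n (p * q) \<Longrightarrow>
      (\<And>a. a < int (table u) \<or> a > int (table u + p * q) \<Longrightarrow> mem s' a = mem s a) \<Longrightarrow> Q s'"
  shows "wp X L item_loop Q s"
  unfolding item_loop_def
proof (rule wp_WhilePos[where N = n and Inv = "\<lambda>k s'. (\<forall>r. r \<notin> {10, 11, 12} \<longrightarrow> reg s' r = reg s r) \<and>
    reg s' 10 = int (6 * k + 4) \<and> reg s' 11 = 2 ^ k \<and>
    (\<forall>t\<le>p * q. mem s' (int (table u + t)) = knap q j (gain q j) k t) \<and>
    (\<forall>a. a < int (table u) \<or> a > int (table u + p * q) \<longrightarrow> mem s' a = mem s a)"], goal_cases)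
  case 1
  show ?case using X_ge by linarith
next
  case 2 show ?case using regs zero by auto
next
  case (3 k s')
  have q: "1 \<le> q" "j \<le> q" "q \<le> 2 * n" using qq_jj[OF u] by (auto simp: q_def j_def)
  have base_table: "base \<le> table u" by (simp add: table_def)
  have hd: "reg s' 0 = int base" "reg s' 2 = int p" "reg s' 8 = int q"
    using 3(2) sc regs by (auto simp: scaled_def header_def)
  have b1: "\<bar>int (p * q + 1)\<bar> < 2 ^ L"
    using capacity_le[OF q(3)] by (intro small) simp
  have "(2::int) ^ Suc k \<le> P" unfolding P_def using 3(1) by (intro power_increasing) auto
  then have b2: "\<bar>2 ^ k + 2 ^ k :: int\<bar> < 2 ^ L"
    using less_two_power_L_mono[of "2 ^ Suc k" 1] P_le by simp
  have b3: "\<bar>int (6 * k + 10)\<bar> < 2 ^ L" using 3(1) by (intro small) simp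
  let ?s = "s'\<lparr>reg := (reg s')(12 := int (p * q + 1))\<rparr>"
  have "scaled ?s"
    by (rule scaled_cong[OF sc]) (use 3(2) base_table in auto)
  then have "wp X L (Seq capacity_loop (Seq (Assign 11 (Plus (Reg 11) (Reg 11))) (Assign 10 (Plus (Reg 10) (Const 6)))))
    (\<lambda>s'. (\<forall>r. r \<notin> {10, 11, 12} \<longrightarrow> reg s' r = reg s r) \<and>
    reg s' 10 = int (6 * Suc k + 4) \<and> reg s' 11 = 2 ^ Suc k \<and>
    (\<forall>t\<le>p * q. mem s' (int (table u + t)) = knap q j (gain q j) (Suc k) t) \<and>
    (\<forall>a. a < int (table u) \<or> a > int (table u + p * q) \<longrightarrow> mem s' a = mem s a)) ?s"
  proof (intro wp_Seq wp_capacity_loop[where u = u and k = k], goal_cases)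
    case (11 s'')
    have r: "reg s'' 11 = 2 ^ k" "reg s'' 10 = int (6 * k + 4)"
      using 11(2)[of 11] 11(2)[of 10] 3(2) by auto
    show ?case
      by (intro wp_Seq wp_Assign) (use r 11 3 b2 b3 in \<open>auto simp: q_def j_def\<close>)
  qed (use 3 u regs in \<open>auto simp: q_def j_def\<close>)
  then show ?case
    using hd b1 3 by (auto simp: base_def add.commute intro!: wp_Seq[of _ _ "Assign 12 e" for e] wp_Assign)
next
  case (4 s')
  then have "Q s'" by (intro Q) auto
  then show ?case using 4 sc by (simp add: scaled_def header_def base_def)
qed

text \<open>\<open>u\<close> is the next pair to examine. The first disjunct describes the start,
  where \<open>0 / 1\<close> stands for no pair at all.\<close>

definition best_so_far :: "nat \<Rightarrow> int \<Rightarrow> int \<Rightarrow> bool" where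
  "best_so_far u b bq \<longleftrightarrow> (u = 1 \<and> b = 0 \<and> bq = 1) \<or>
     (\<exists>v\<in>{1..<u}. b = score v \<and> bq = int (qq v) \<and>
        (\<forall>u'\<in>{1..<u}. score u' div P * int (qq v) \<le> score v div P * int (qq u')))"

text \<open>Transitivity of comparing fractions in cross-multiplied form: the old inequality is
  multiplied by the new \<open>q\<close>, the new one by that of \<open>u'\<close>, and the positive
  old denominator is cancelled.\<close>

lemma best_so_far_improve:
  assumes u: "u \<in> {1..<(n + 1) * (n + 1)}" and best: "best_so_far u b bq"
    and gt: "b div P * int (qq u) < score u div P * bq"
  shows "best_so_far (Suc u) (score u) (int (qq u))"
proof -
  have "score u' div P * int (qq u) \<le> score u div P * int (qq u')" if u': "u' \<in> {1..<Suc u}" for u'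
  proof (cases "u' = u")
    case False
    then have "u' \<in> {1..<u}" using u' by auto
    then obtain v where v: "v \<in> {1..<u}" "b = score v" "bq = int (qq v)"
        "score u' div P * int (qq v) \<le> score v div P * int (qq u')"
      using best by (auto simp: best_so_far_def)
    have pos: "0 < int (qq v)" "0 \<le> int (qq u')" "0 \<le> int (qq u)"
      using qq_jj(1)[of v] v(1) u by auto
    have "(score u' div P * int (qq u)) * int (qq v) = (score u' div P * int (qq v)) * int (qq u)"
      by (simp only: mult_ac)
    also have "\<dots> \<le> (score v div P * int (qq u')) * int (qq u)"
      using v(4) pos by (intro mult_right_mono) auto
    also have "\<dots> = (b div P * int (qq u)) * int (qq u')"
      by (simp only: mult_ac v)
    also have "\<dots> \<le> (score u div P * bq) * int (qq u')"
      using gt pos by (intro mult_right_mono) auto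
    also have "\<dots> = (score u div P * int (qq u')) * int (qq v)"
      by (simp only: mult_ac v)
    finally show ?thesis using pos by (simp only: mult_le_cancel_right_pos)
  qed simp
  then show ?thesis using u by (auto simp: best_so_far_def)
qed

text \<open>At the start a failed comparison is impossible, because the first score beats
  \<open>0 / 1\<close>; hence a genuine earlier pair is being kept.\<close>

lemma best_so_far_keep:
  assumes u: "u \<in> {1..<(n + 1) * (n + 1)}" and best: "best_so_far u b bq"
    and le: "\<not> b div P * int (qq u) < score u div P * bq"
  shows "best_so_far (Suc u) b bq"
proof -
  have "\<not> (u = 1 \<and> b = 0 \<and> bq = 1)"
    using le score_div_P_pos[OF u] by auto
  then obtain v where v: "v \<in> {1..<u}" "b = score v" "bq = int (qq v)"
      "\<forall>u'\<in>{1..<u}. score u' div P * int (qq v) \<le> score v div P * int (qq u')"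
    using best by (auto simp: best_so_far_def)
  then have "\<forall>u'\<in>{1..<Suc u}. score u' div P * int (qq v) \<le> score v div P * int (qq u')"
    using le by (auto simp: less_Suc_eq)
  then show ?thesis
    using v unfolding best_so_far_def by (intro disjI2 bexI[of _ v]) auto
qed

definition pair_invariant :: "nat \<Rightarrow> ram_state \<Rightarrow> bool" where
  "pair_invariant u s \<longleftrightarrow> scaled s \<and> reg s 6 = int u \<and> (\<forall>a\<ge>int (table u). mem s a = 0) \<and>
     best_so_far u (reg s 13) (reg s 14)"

lemma wp_compare:
  assumes u: "u \<in> {1..<(n + 1) * (n + 1)}" and s: "reg s 4 = P" "reg s 8 = int (qq u)" "reg s 15 = score u"
    and best: "best_so_far u (reg s 13) (reg s 14)"
    and Q: "\<And>s'. (\<And>r. r \<notin> {13, 14} \<Longrightarrow> reg s' r = reg s r) \<Longrightarrow> mem s' = mem s \<Longrightarrow>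
      best_so_far (Suc u) (reg s' 13) (reg s' 14) \<Longrightarrow> Q s'"
  shows "wp X L compare Q s"
proof -
  have b: "\<bar>score u\<bar> < 2 ^ L" "\<bar>int (qq u)\<bar> < 2 ^ L"
    using less_two_power_L_mono[OF abs_score_le[OF u]] small[of "qq u"] qq_jj[OF u] by auto
  show ?thesis
    unfolding compare_def
  proof (rule wp_IfPos)
    assume "0 < eval_expr (Minus (Times (Div (Reg 15) (Reg 4)) (Reg 14)) (Times (Div (Reg 13) (Reg 4)) (Reg 8))) s"
    then have "best_so_far (Suc u) (score u) (int (qq u))"
      using s by (intro best_so_far_improve[OF u best]) simp
    then show "wp X L (Seq (Assign 13 (Reg 15)) (Assign 14 (Reg 8))) Q s"
      by (intro wp_Seq wp_Assign Q) (use s b in auto)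
  next
    assume "\<not> 0 < eval_expr (Minus (Times (Div (Reg 15) (Reg 4)) (Reg 14)) (Times (Div (Reg 13) (Reg 4)) (Reg 8))) s"
    then have "best_so_far (Suc u) (reg s 13) (reg s 14)"
      using s by (intro best_so_far_keep[OF u best]) simp
    then show "wp X L Skip Q s"
      by (intro wp_Skip Q) auto
  qed
qed

lemma wp_pair_body:
  assumes u: "u \<in> {1..<(n + 1) * (n + 1)}" and inv: "pair_invariant u s"
  shows "wp X L pair_body (pair_invariant (Suc u)) s"
proof -
  define q where "q = qq u"
  define j where "j = jj u"
  have q: "1 \<le> q" "j \<le> q" "q \<le> 2 * n" using qq_jj[OF u] by (auto simp: q_def j_def)
  have pq: "p * q \<le> 2 * (n * n)" by (rule capacity_le[OF q(3)])
  have sc: "scaled s" and r6: "reg s 6 = int u" and zero: "\<And>a. a \<ge> int (table u) \<Longrightarrow> mem s a = 0"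
    and best: "best_so_far u (reg s 13) (reg s 14)"
    using inv by (auto simp: pair_invariant_def)
  have hd: "reg s 0 = int base" "reg s 1 = int n" "reg s 2 = int p" "reg s 4 = P"
    using sc by (auto simp: scaled_def header_def)
  have divu: "int u div (int n + 1) = int (u div (n + 1))" by (simp add: zdiv_int)
  have jeq: "int u - (int n + 1) * int (u div (n + 1)) = int j"
    unfolding divu[symmetric] minus_mult_div_eq_mod by (simp add: j_def jj_def zmod_int)
  have qeq: "int j + int (u div (n + 1)) = int q" by (simp add: q_def j_def qq_def jj_def)
  have teq: "int base + int u * (2 * (int n * int n) + 1) = int (table u)" by (simp add: table_def)
  have "table u \<le> base + (n + 1) * (n + 1) * (2 * (n * n) + 1)"
    unfolding table_def using u by (intro add_mono mult_right_mono) auto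
  then have "int (table u) \<le> int base + int ((n + 1) * (n + 1)) * int (2 * (n * n) + 1)"
    by (metis of_nat_add of_nat_le_iff of_nat_mult)
  also have "\<dots> \<le> B + B ^ 2 * B ^ 2"
  proof -
    have "(n + 1) * (n + 1) \<le> 2 * (n * n) + 8 * n + 8" by (simp add: algebra_simps)
    note int_le_X_bound[OF this]
    moreover have "int (2 * (n * n) + 1) \<le> B ^ 2" by (rule int_le_X_bound) simp
    ultimately show ?thesis
      using B_ge by (intro add_mono mult_mono) (simp_all add: base_def)
  qed
  also have "\<dots> \<le> 2 * B ^ 4" using B_power_mono(1)[of 1 4] by simp
  also have "\<dots> \<le> B * B ^ 4" using B_ge by (intro mult_right_mono) auto
  finally have "\<bar>int (table u)\<bar> \<le> B ^ 5" by (simp add: numeral_eq_Suc)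
  then have bt: "\<bar>int (table u)\<bar> < 2 ^ L" by (rule less_two_power_L_mono) simp
  have b: "\<bar>int j\<bar> < 2 ^ L" "\<bar>int q\<bar> < 2 ^ L" "\<bar>4\<bar> < (2::int) ^ L" "\<bar>1\<bar> < (2::int) ^ L"
    using small[of j] small[of q] small[of 4] small[of 1] q by auto
  have bs: "\<bar>score u\<bar> < 2 ^ L"
    using less_two_power_L_mono[OF abs_score_le[OF u]] by simp
  have "Suc u \<le> (n + 1) * (n + 1)" using u by auto
  then have bu: "\<bar>int u + 1\<bar> < 2 ^ L" using small[of "Suc u"] by (simp add: algebra_simps)
  have next_table: "table (Suc u) = table u + (2 * (n * n) + 1)" by (simp add: table_def)
  have base_table: "base \<le> table u" by (simp add: table_def)
  let ?tail = "Seq (Assign 15 (Minus (Mem (Plus (Reg 9) (Times (Reg 2) (Reg 8))))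
             (Times (Times (Reg 4) (Reg 7)) (Mem (Const 2)))))
     (Seq compare (Assign 6 (Plus (Reg 6) (Const 1))))"
  have tail: "wp X L ?tail (pair_invariant (Suc u)) s'"
    if s': "reg s' 7 = int j" "reg s' 8 = int q" "reg s' 9 = int (table u)"
      "\<And>r. r \<notin> {7, 8, 9, 10, 11, 12} \<Longrightarrow> reg s' r = reg s r"
      "mem s' (int (table u + p * q)) = knap q j (gain q j) n (p * q)"
      "\<And>a. a < int (table u) \<or> a > int (table u + p * q) \<Longrightarrow> mem s' a = mem s a" for s'
  proof -
    have sc': "scaled s'"
      by (rule scaled_cong[OF sc]) (use s' base_table in auto)
    have "\<forall>m<3 * n + 1. mem s' (int (2 * m + 2)) = V m" using sc' by (simp add: scaled_def)
    from this[rule_format, of 0] have v0: "mem s' 2 = V 0" by simp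
    have val: "mem s' (int (table u) + int p * int q) - P * int j * V 0 = score u"
      using s'(5) by (simp add: score_def q_def j_def)
    have hd': "reg s' 2 = int p" "reg s' 4 = P"
      using sc' by (auto simp: scaled_def header_def)
    have zero': "mem s' a = 0" if "a \<ge> int (table (Suc u))" for a
    proof -
      have "int (table (Suc u)) > int (table u + p * q)"
        unfolding of_nat_less_iff using pq next_table by simp
      moreover have "int (table u) \<le> int (table (Suc u))"
        unfolding of_nat_le_iff using next_table by simp
      ultimately show ?thesis using s'(6)[of a] zero[of a] that by simp
    qed
    show ?thesis
    proof (intro wp_Seq wp_Assign[of _ _ _ _ 15], goal_cases)
      case 1
      then show ?case using bs val hd' v0 s'(1-3) by simp
    next
      case 2
      show ?case
      proof (rule wp_compare[OF u], goal_cases)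
        case (5 s'')
        have "scaled s''"
          by (rule scaled_cong[OF sc']) (use 5 in auto)
        then show ?case
          using 5 zero' r6 s'(4)[of 6] bu
          by (intro wp_Assign) (auto simp: pair_invariant_def intro: scaled_cong)
      qed (use hd' s' best val v0 in \<open>auto simp: q_def\<close>)
    qed
  qed
  have items: "wp X L (Seq item_loop ?tail) (pair_invariant (Suc u)) s'"
    if s': "reg s' 7 = int j" "reg s' 8 = int q" "reg s' 9 = int (table u)" "reg s' 10 = 4" "reg s' 11 = 1"
      "\<And>r. r \<notin> {7, 8, 9, 10, 11, 12} \<Longrightarrow> reg s' r = reg s r" "mem s' = mem s" for s'
  proof (rule wp_Seq, rule wp_item_loop[OF u], goal_cases)
    case 1
    show ?case by (rule scaled_cong[OF sc]) (use s' in auto)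
  next
    case (8 s'')
    show ?case
      by (rule tail) (use 8 s' in \<open>auto simp: q_def j_def\<close>)
  qed (use s' zero in \<open>auto simp: q_def j_def\<close>)
  show ?thesis
    unfolding pair_body_def
    by (intro wp_Seq[of _ _ "Assign r e" for r e] wp_Assign items)
      (use hd r6 divu jeq qeq teq bt b in \<open>simp_all add: add.commute\<close>)
qed

lemma wp_search_phase:
  assumes sc: "scaled s" and zero: "\<And>a. a \<ge> int base \<Longrightarrow> mem s a = 0"
    and Q: "\<And>s'. pair_invariant ((n + 1) * (n + 1)) s' \<Longrightarrow> Q s'"
  shows "wp X L search_phase Q s"
proof -
  have b: "\<bar>0\<bar> < (2::int) ^ L" "\<bar>1\<bar> < (2::int) ^ L" using small[of 1] by auto
  have loop: "wp X L pair_loop Q s'" if "pair_invariant 1 s'" for s'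
    unfolding pair_loop_def
  \<comment> \<open>Iteration \<open>i\<close> treats the pair with index \<open>Suc i\<close>,
    since index \<open>0\<close> would mean \<open>q = 0\<close>.\<close>
  proof (rule wp_WhilePos[where N = "(n + 1) * (n + 1) - 1" and Inv = "\<lambda>i. pair_invariant (Suc i)"], goal_cases)
    case 1 show ?case using X_ge(1) by linarith
  next
    case 2 show ?case using that by (simp add: One_nat_def)
  next
    case (3 i s)
    then have u: "Suc i \<in> {1..<(n + 1) * (n + 1)}" by auto
    then have "int (Suc i) < int ((n + 1) * (n + 1))" by (simp only: of_nat_less_iff) simp
    then show ?case
      using wp_pair_body[OF u 3(2)] 3(2)
      by (simp add: pair_invariant_def scaled_def header_def algebra_simps)
  next
    case (4 s)
    then have inv: "pair_invariant ((n + 1) * (n + 1)) s" by simp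
    then show ?case
      using Q[OF inv] by (simp add: pair_invariant_def scaled_def header_def algebra_simps)
  qed
  have "scaled (s\<lparr>reg := (reg s)(6 := 1, 13 := 0, 14 := 1)\<rparr>)"
    by (rule scaled_cong[OF sc]) auto
  moreover have "mem s a = 0" if "a \<ge> int (table 1)" for a
  proof (rule zero)
    have "int base \<le> int (table 1)" by (simp add: table_def)
    then show "int base \<le> a" using that by linarith
  qed
  ultimately have "pair_invariant 1 (s\<lparr>reg := (reg s)(6 := 1, 13 := 0, 14 := 1)\<rparr>)"
    by (simp add: pair_invariant_def best_so_far_def)
  from loop[OF this] show ?thesis
    unfolding search_phase_def
    by (intro wp_Seq wp_Assign) (use b in simp_all)
qed

section \<open>Decoding and writing the solution\<close>

lemma wp_output_loop:
  assumes s: "reg s 1 = int n" "reg s 8 = m" "reg s 10 = 0" and m: "0 \<le> m" "m < P"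
    and Q: "\<And>s'. (\<And>r. r \<notin> {8, 10} \<Longrightarrow> reg s' r = reg s r) \<Longrightarrow>
      (\<And>i. i < n \<Longrightarrow> mem s' (int i) = m div 2 ^ i mod 2) \<Longrightarrow> Q s'"
  shows "wp X L output_loop Q s"
  unfolding output_loop_def
proof (rule wp_WhilePos[where N = n and Inv = "\<lambda>i s'. (\<forall>r. r \<notin> {8, 10} \<longrightarrow> reg s' r = reg s r) \<and>
    reg s' 8 = m div 2 ^ i \<and> reg s' 10 = int i \<and> (\<forall>k<i. mem s' (int k) = m div 2 ^ k mod 2)"], goal_cases)
  case 1 show ?case using X_ge by linarith
next
  case 2 show ?case using s by simp
next
  case (3 i s')
  have hd: "reg s' 1 = int n" using 3(2) s by auto
  have bit: "m div 2 ^ i - 2 * (m div 2 ^ i div 2) = m div 2 ^ i mod 2"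
    by (rule minus_mult_div_eq_mod)
  have half: "m div 2 ^ i div 2 = m div 2 ^ Suc i"
    by (subst power_Suc2, subst zdiv_zmult2_eq) simp_all
  have "\<bar>m div 2 ^ k\<bar> \<le> B" for k
    using abs_div_le_abs[of m "2 ^ k"] m P_le by linarith
  then have b1: "\<bar>m div 2 ^ k\<bar> < 2 ^ L" for k
    using less_two_power_L_mono[of "m div 2 ^ k" 1] by simp
  have b2: "\<bar>m div 2 ^ i mod 2\<bar> < 2 ^ L" using small[of 1] small[of 0] by (cases "even (m div 2 ^ i)") (auto simp: odd_iff_mod_2_eq_one even_iff_mod_2_eq_zero)
  have b3: "\<bar>int i + 1\<bar> < 2 ^ L" using small[of "Suc i"] 3(1) by (simp add: add.commute)
  show ?case
    by (intro conjI wp_Seq wp_Assign wp_Store)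
      (use 3 hd bit half b1[of "Suc i"] b2 b3 in \<open>auto simp: less_Suc_eq\<close>)
next
  case (4 s')
  then show ?case using Q[of s'] s by auto
qed

lemma wp_write_phase:
  assumes inv: "pair_invariant ((n + 1) * (n + 1)) s"
  shows "wp X L write_phase (\<lambda>s'. reg s' 0 = int (n + 2) \<and> solves_r2st I (output_word s')) s"
proof -
  have sc: "scaled s" using inv by (simp add: pair_invariant_def)
  then have hd: "reg s 1 = int n" "reg s 2 = int p" "reg s 3 = D" "reg s 4 = P" "reg s 5 = K"
    by (auto simp: scaled_def header_def)
  \<comment> \<open>At least one pair has been examined, which rules out the dummy start
    value.\<close>
  have "1 < (n + 1) * (n + 1)" using n_pos mult_le_mono[of 2 "n + 1" 1 "n + 1"] by linarith
  then obtain u where u: "u \<in> {1..<(n + 1) * (n + 1)}" "reg s 13 = score u" "reg s 14 = int (qq u)"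
      "\<And>u'. u' \<in> {1..<(n + 1) * (n + 1)} \<Longrightarrow> score u' div P * int (qq u) \<le> score u div P * int (qq u')"
    using inv by (auto simp: pair_invariant_def best_so_far_def)
  obtain x where x: "x \<in> first_stage I" "robust_cost I x = optimal_value I"
    "\<forall>i<n. score u mod P div 2 ^ i mod 2 = int (x (Suc i))"
    "optimal_value I = of_int (K * int p * int (qq u) - score u div P) / of_int (int (qq u) * D)"
    by (rule best_score_optimal[OF u(1,4)])
  note q = qq_jj[OF u(1)]
  have m: "0 \<le> score u mod P" "score u mod P < P" using P_pos by auto
  have meq: "score u - P * (score u div P) = score u mod P" by (rule minus_mult_div_eq_mod)
  have bm: "\<bar>score u mod P\<bar> < 2 ^ L"
    using less_two_power_L_mono[of "score u mod P" 1] m P_le by simp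
  have dle: "\<bar>score u div P\<bar> \<le> B ^ 10"
    using abs_div_le_abs[of "score u" P] abs_score_le[OF u(1)] by linarith
  then have bd: "\<bar>score u div P\<bar> < 2 ^ L" by (rule less_two_power_L_mono) simp
  have qB: "int (qq u) \<le> B" "int p \<le> B" using q p_le_n B_ge by auto
  have "K * int p * int (qq u) \<le> B ^ 6 * B * B"
    using K_bounds qB B_ge by (intro mult_mono) auto
  also have "\<dots> = B ^ 8" by (simp add: numeral_eq_Suc)
  also have "\<dots> \<le> B ^ 10" by (rule B_power_mono) simp
  finally have "K * int p * int (qq u) \<le> B ^ 10" .
  then have "\<bar>K * int p * int (qq u) - score u div P\<bar> \<le> 2 * B ^ 10"
  proof -
    have "0 \<le> K * int p * int (qq u)" using K_bounds(1) by simp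
    then show ?thesis using dle \<open>K * int p * int (qq u) \<le> B ^ 10\<close> by linarith
  qed
  also have "\<dots> \<le> B * B ^ 10" using B_ge by (intro mult_right_mono) auto
  finally have "\<bar>K * int p * int (qq u) - score u div P\<bar> \<le> B ^ 11" by (simp add: numeral_eq_Suc)
  then have bv: "\<bar>K * int p * int (qq u) - score u div P\<bar> < 2 ^ L"
    by (rule less_two_power_L_mono) simp
  have "int (qq u) * D \<le> B * B" using qB D_le D_pos B_ge by (intro mult_mono) auto
  then have "\<bar>int (qq u) * D\<bar> \<le> B ^ 2" using D_pos by (simp add: power2_eq_square)
  then have bD: "\<bar>int (qq u) * D\<bar> < 2 ^ L" by (rule less_two_power_L_mono) simp
  have b0: "\<bar>0\<bar> < (2::int) ^ L" "\<bar>int n + 2\<bar> < 2 ^ L" using small[of "n + 2"] by (auto simp: add.commute)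
  have upto: "[0..int k - 1] = map int [0..<k]" for k
    by (induction k) (simp_all add: upto_rec2)
  have word: "output_word s' = map (\<lambda>i. mem s' (int i)) [0..<n] @ [mem s' (int n), mem s' (int n + 1)]"
    if "reg s' 0 = int (n + 2)" for s'
    using that upto[of "n + 2"] by (simp add: output_word_def comp_def upt_add_eq_append numeral_2_eq_2 add.commute)
  have "map (\<lambda>i. int (x i)) [1..<n + 1] = map (\<lambda>i. int (x (Suc i))) [0..<n]"
  proof -
    have "[1..<n + 1] = map Suc [0..<n]"
      by (simp add: map_Suc_upt One_nat_def)
    then show ?thesis by (simp only: map_map comp_def)
  qed
  then have solves: "solves_r2st I (map (\<lambda>i. int (x (Suc i))) [0..<n]
      @ [K * int p * int (qq u) - score u div P, int (qq u) * D])"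
    unfolding solves_r2st_def using x q D_pos
    by (intro exI[of _ x] exI[of _ "K * int p * int (qq u) - score u div P"] exI[of _ "int (qq u) * D"])
      auto
  let ?tail = "Seq (Store (Reg 1) (Minus (Times (Times (Reg 5) (Reg 2)) (Reg 14)) (Reg 7)))
     (Seq (Store (Plus (Reg 1) (Const 1)) (Times (Reg 14) (Reg 3)))
          (Assign 0 (Plus (Reg 1) (Const 2))))"
  have tail: "wp X L ?tail (\<lambda>s'. reg s' 0 = int (n + 2) \<and> solves_r2st I (output_word s')) s'"
    if s': "reg s' 7 = score u div P" "\<And>r. r \<notin> {7, 8, 10} \<Longrightarrow> reg s' r = reg s r"
      "\<And>i. i < n \<Longrightarrow> mem s' (int i) = score u mod P div 2 ^ i mod 2" for s'
  proof -
    have r: "reg s' 1 = int n" "reg s' 2 = int p" "reg s' 3 = D" "reg s' 5 = K" "reg s' 14 = int (qq u)"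
      using s'(2) hd u by auto
    have cells: "map (\<lambda>i. mem s' (int i)) [0..<n] = map (\<lambda>i. int (x (Suc i))) [0..<n]"
      using s'(3) x(3) by simp
    have res: "reg t 0 = int (n + 2) \<and> solves_r2st I (output_word t)"
      if "reg t 0 = int n + 2" "mem t = (mem s')(int n := K * int p * int (qq u) - score u div P,
        int n + 1 := int (qq u) * D)" for t
    proof
      show t0: "reg t 0 = int (n + 2)" using that by simp
      have "map (\<lambda>i. mem t (int i)) [0..<n] = map (\<lambda>i. mem s' (int i)) [0..<n]"
        using that by auto
      moreover have "mem t (int n) = K * int p * int (qq u) - score u div P" "mem t (int n + 1) = int (qq u) * D"
        using that(2) by simp_all
      ultimately show "solves_r2st I (output_word t)"
        using solves by (simp only: word[OF t0] cells)
    qed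
    show ?thesis
      by (intro wp_Seq wp_Store wp_Assign res) (use r s' bv bD b0 in simp_all)
  qed
  have loop: "wp X L (Seq output_loop ?tail) (\<lambda>s'. reg s' 0 = int (n + 2) \<and> solves_r2st I (output_word s')) s'"
    if s': "reg s' 7 = score u div P" "reg s' 8 = score u mod P" "reg s' 10 = 0"
      "\<And>r. r \<notin> {7, 8, 10} \<Longrightarrow> reg s' r = reg s r" for s'
    by (intro wp_Seq wp_output_loop[OF _ s'(2,3) m] tail) (use s' hd in auto)
  show ?thesis
    unfolding write_phase_def
    by (intro wp_Seq[of _ _ "Assign r e" for r e] wp_Assign loop)
      (use hd u meq bm bd b0 in simp_all)
qed

lemma run_selection_program:
  "\<exists>t s. run selection_program (input_state (encode_r2st I)) t s \<and>
     t \<le> poly (cost_poly selection_program) X * L \<and> bounded L s \<and>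
     reg s 0 = int (n + 2) \<and> solves_r2st I (output_word s)"
proof -
  have "wp X L selection_program (\<lambda>s'. reg s' 0 = int (n + 2) \<and> solves_r2st I (output_word s'))
      (input_state (encode_r2st I))"
    unfolding selection_program_def
    by (intro wp_Seq wp_read_phase wp_search_phase wp_write_phase)
  then show ?thesis
    using L_pos initial_bounded unfolding wp_def by blast
qed

end

theorem theorem14:
  shows "poly_time_solvable valid_r2st encode_r2st solves_r2st"
proof -
  define c where "c = cost_poly selection_program"
  \<comment> \<open>With input size \<open>W\<close>, the running time is at most
    \<open>poly c (W * W)\<close> times \<open>L = 12 * W\<close>, and the output has size at most
    \<open>W * (L + 2)\<close>.\<close>
  define Q :: "nat poly" where "Q = pcompose c [:0, 0, 1:] * [:0, 12:] + [:0, 2, 12:]"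
  have "\<exists>t s. run selection_program (input_state (encode_r2st I)) t s
      \<and> t + word_size (output_word s) \<le> poly Q (word_size (encode_r2st I))
      \<and> solves_r2st I (output_word s)" if "valid_r2st I" for I
  proof -
    interpret r2st_input I by unfold_locales (rule that)
    obtain t s where ts: "run selection_program (input_state (encode_r2st I)) t s"
        "t \<le> poly c X * L" "bounded L s" "reg s 0 = int (n + 2)" "solves_r2st I (output_word s)"
      using run_selection_program unfolding c_def by blast
    have "word_size (output_word s) \<le> (n + 2) * (L + 2)"
      by (rule word_size_output_le[OF ts(3)]) (simp add: ts(4))
    also have "\<dots> \<le> W * (L + 2)" using W_ge by (intro mult_le_mono1) simp
    finally have "t + word_size (output_word s) \<le> poly c X * L + W * (L + 2)"
      using ts(2) by (rule add_mono[rotated])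
    also have "\<dots> = poly Q W"
      by (simp add: Q_def poly_pcompose X_def L_def algebra_simps)
    finally show ?thesis using ts W_def by auto
  qed
  then show ?thesis
    unfolding poly_time_solvable_def by blast
qed

end
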